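(* Let $\mu$ be a finite, non-negative Borel measure on $[0,\infty)$ and let $\varphi(t)=\int_0^\infty e^{-tx}\,d\mu(x)$ for $t\ge 0$. Then $\mu$ is log-concave if and only if for every integer $n\ge 1$ the function $t\mapsto \left|\varphi^{(n-1)}(t)\right|^{-1/n}$ is convex in $t\in(0,\infty)$.
   Context: A function $f:[0,\infty)\to\mathbb{R}$ is log-concave if $f\ge 0$ and $f(\lambda x+(1-\lambda)y)\ge f(x)^\lambda f(y)^{1-\lambda}$ for all $x,y\ge 0$, $0<\lambda<1$. A finite Borel measure $\mu$ on $[0,\infty)$ is log-concave if either $\mu = c\,\delta_{x_0}$ for some $c\ge 0$ and $x_0\in[0,\infty)$, or $\mu$ is absolutely continuous with a log-concave density $f:[0,\infty)\to\mathbb{R}$. Convention: $0^{-1/n}=+\infty$, and the function identically equal to $+\infty$ is regarded as convex (this only matters when $\mu=c\,\delta_0$ for some $c\ge 0$). *)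

theory Defs
  imports "HOL-Probability.Giry_Monad"
begin

definition log_concave_fun :: "(real \<Rightarrow> real) \<Rightarrow> bool" where
  "log_concave_fun f \<longleftrightarrow>
     (\<forall>x\<ge>0. 0 \<le> f x) \<and>
     (\<forall>x\<ge>0. \<forall>y\<ge>0. \<forall>u. 0 < u \<and> u < 1 \<longrightarrow>
        f (u * x + (1 - u) * y) \<ge> f x powr u * f y powr (1 - u))"

(* Measures on the half-line have space {0..} itself (not the whole real line with a
   support condition), hence the restricted spaces.  The values of f at negative
   arguments are irrelevant. *)
abbreviation borel_half_line :: "real measure" where
  "borel_half_line \<equiv> restrict_space borel {0..}"

definition log_concave_measure :: "real measure \<Rightarrow> bool" where
  "log_concave_measure M \<longleftrightarrow>
     (\<exists>c\<ge>0. \<exists>x0\<ge>0. M = scale_measure (ennreal c) (return borel_half_line x0)) \<or>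
     (\<exists>f. f \<in> borel_measurable borel_half_line \<and> log_concave_fun f \<and>
          M = density (restrict_space lborel {0..}) (\<lambda>x. ennreal (f x)))"

(* For finite M the integrand is bounded, hence integrable, when t >= 0; where it fails
   to be integrable (possible only for t < 0) the value is 0 by the library's convention. *)
definition laplace_transform :: "real measure \<Rightarrow> real \<Rightarrow> real" where
  "laplace_transform M t = (\<integral>x. exp (- t * x) \<partial>M)"

(* y to the power -1/n for y >= 0 and n >= 1.  The case distinction is needed because
   0 powr a = 0 in the library, whereas here 0 to the power -1/n is infinity. *)
definition neg_root :: "nat \<Rightarrow> real \<Rightarrow> ereal" where
  "neg_root n y = (if y = 0 then \<infinity> else ereal (y powr (- 1 / real n)))"

(* Convexity of a function with values in (-\<infinity>, \<infinity>].  The library's 0 * \<infinity> = 0 makes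
   the cases u = 0 and u = 1 hold trivially. *)
definition ereal_convex_on :: "real set \<Rightarrow> (real \<Rightarrow> ereal) \<Rightarrow> bool" where
  "ereal_convex_on S f \<longleftrightarrow> convex S \<and>
     (\<forall>x\<in>S. \<forall>y\<in>S. \<forall>u v. 0 \<le> u \<and> 0 \<le> v \<and> u + v = 1 \<longrightarrow>
        f (u * x + v * y) \<le> ereal u * f x + ereal v * f y)"

lemma ereal_convex_on_ereal_iff:
  "ereal_convex_on S (\<lambda>x. ereal (f x)) \<longleftrightarrow> convex_on S f"
  by (auto simp: ereal_convex_on_def convex_on_def)

lemma ereal_convex_on_top:
  assumes "convex S"
  shows "ereal_convex_on S (\<lambda>_. \<infinity>)"
  unfolding ereal_convex_on_def
proof (intro conjI ballI allI impI)
  show "convex S" by (fact assms)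
next
  fix u v :: real assume "0 \<le> u \<and> 0 \<le> v \<and> u + v = 1"
  then have "0 < u \<or> 0 < v" and "0 \<le> u" "0 \<le> v" by linarith+
  then show "\<infinity> \<le> ereal u * \<infinity> + ereal v * \<infinity>" by auto
qed

end

theory Submission
  imports Defs "HOL-Probability.Distribution_Functions"
begin

text \<open>
  Write \<open>M\<^sub>k(t)\<close> for the integral of \<open>x\<^sup>k e\<^sup>-\<^sup>t\<^sup>x\<close>, which is \<open>(-1)\<^sup>k\<close> times the \<open>k\<close>-th derivative of
  the Laplace transform.  Differentiating \<open>M\<^bsub>n-1\<^esub>\<close> to the power \<open>-1/n\<close> twice shows that the
  convexity condition for \<open>n\<close> says \<open>n M\<^bsub>n-1\<^esub> M\<^bsub>n+1\<^esub> \<le> (n+1) M\<^sub>n\<^sup>2\<close> for all \<open>t > 0\<close>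
  (\<open>neg_root_convex_iff_moment_inequality\<close>); equivalently, the sequence \<open>n \<mapsto> t\<^sup>n M\<^sub>n(t) / n!\<close> is
  log-concave for every \<open>t\<close>.  Only measures concentrated at \<open>0\<close>, whose moments of positive order vanish, are
  treated separately.

  If the measure has a log-concave density \<open>f\<close>, put \<open>g(x) = e\<^sup>-\<^sup>t\<^sup>x f(x)\<close> and write the products of moments as
  double integrals of \<open>g(x) g(y)\<close> against polynomials, sliced along the lines \<open>x + y = s\<close>.  On such a line
  \<open>x \<mapsto> g(x) g(s - x)\<close> is symmetric and decreases away from \<open>s/2\<close>, whereas the symmetrised
  polynomial has integral zero and changes sign from plus to minus as \<open>\<bar>x - s/2\<bar>\<close> grows.  So
  the inequality holds on each line (\<open>symmetric_unimodal_beta_inequality\<close>).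

  For the converse, \<open>t\<^sup>n M\<^sub>n(t) / n!\<close> is the mass at \<open>n\<close> of the mixture of the Poisson distributions
  with mean \<open>t x\<close>, where \<open>x\<close> is distributed according to the measure.  Rescaled by \<open>1/t\<close> these mixtures
  converge to the measure as \<open>t\<close> tends to infinity.  A log-concave sequence satisfies
  \<open>a\<^sub>i a\<^bsub>j+d\<^esub> \<le> a\<^bsub>i+d\<^esub> a\<^sub>j\<close> for \<open>i \<le> j\<close>; summing over windows and passing to the limit gives the exchange
  inequality \<open>\<mu>(I) \<mu>(J + d) \<le> \<mu>(I + d) \<mu>(J)\<close> for an interval \<open>I\<close> to the left of an interval \<open>J\<close> and
  \<open>d \<ge> 0\<close> (\<open>cdf_exchange\<close>).

  The exchange inequality is an integrated form of log-concavity.  Letting \<open>J\<close> reach to infinity, it shows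
  that the hazard rate is nondecreasing.  Therefore the difference quotients of the tail converge along
  dyadic steps, and they do so boundedly away from the right end of the support, which makes the limit a
  density there (\<open>emeasure_tail_density_Ioc\<close>).  An atom at the right end is possible only if it carries all
  the mass (\<open>no_atom_at_right_end\<close>).  Finally the exchange inequality for short intervals passes to the
  density and gives log-concavity with rational weights; monotonicity of the hazard rate supplies the
  one-sided continuity that extends this to real weights (\<open>exchange_imp_log_concave\<close>).
\<close>

section \<open>Derivatives of the Laplace transform\<close>

definition laplace_moment :: "real measure \<Rightarrow> nat \<Rightarrow> real \<Rightarrow> real" where
  "laplace_moment M k t = (\<integral>x. x ^ k * exp (- t * x) \<partial>M)"

lemma power_times_exp_bounded:
  fixes x t :: real
  assumes "0 < t" "0 \<le> x"
  shows "x ^ k * exp (- t * x) \<le> fact k / t ^ k"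
proof -
  have "(t * x) ^ k / fact k \<le> exp (t * x)"
    using sum_le_suminf[OF summable_exp[of "t * x"], of "{k}"] assms
    by (simp add: exp_def divide_inverse mult.commute)
  then have "(t * x) ^ k * exp (- t * x) \<le> fact k"
    by (simp add: exp_minus field_simps)
  then show ?thesis
    using assms by (simp add: field_simps)
qed

lemma exp_second_order_bound:
  fixes u :: real
  shows "\<bar>exp u - 1 - u\<bar> \<le> u\<^sup>2 * exp \<bar>u\<bar>"
proof -
  obtain s where s: "\<bar>s\<bar> \<le> \<bar>u\<bar>" "exp u = (\<Sum>m<2. u ^ m / fact m) + exp s / fact 2 * u ^ 2"
    using Maclaurin_exp_le[of u 2] by blast
  have "exp u - 1 - u = exp s / 2 * u\<^sup>2"
    using s(2) by (simp add: numeral_2_eq_2)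
  moreover have "exp s \<le> 2 * exp \<bar>u\<bar>"
  proof -
    have "exp s \<le> exp \<bar>u\<bar>" using s(1) by simp
    then show ?thesis using exp_ge_zero[of "\<bar>u\<bar>"] by linarith
  qed
  then have "exp s / 2 * u\<^sup>2 \<le> u\<^sup>2 * exp \<bar>u\<bar>"
    using mult_right_mono[of "exp s" "2 * exp \<bar>u\<bar>" "u\<^sup>2"] by (simp add: mult_ac)
  moreover have "0 \<le> exp s / 2 * u\<^sup>2" by simp
  ultimately show ?thesis by linarith
qed

locale half_line_measure = finite_measure M for M :: "real measure" +
  assumes sets_M: "sets M = sets borel_half_line"
begin

lemma space_M: "space M = {0..}"
  using sets_eq_imp_space_eq[OF sets_M] by (simp add: space_restrict_space)

lemma sets_M_iff: "A \<in> sets M \<longleftrightarrow> A \<in> sets borel \<and> A \<subseteq> {0..}"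
  unfolding sets_M by (subst sets_restrict_space_iff) auto

lemma borel_measurable_M: "f \<in> borel_measurable borel \<Longrightarrow> f \<in> borel_measurable M" for f :: "real \<Rightarrow> 'b::topological_space"
  unfolding measurable_cong_sets[OF sets_M refl] by (rule measurable_restrict_space1)

lemma integrable_power_exp:
  assumes "0 < t"
  shows "integrable M (\<lambda>x. x ^ k * exp (- t * x))"
proof (rule integrable_const_bound)
  show "AE x in M. norm (x ^ k * exp (- t * x)) \<le> fact k / t ^ k"
    using power_times_exp_bounded[OF assms] by (intro AE_I2) (auto simp: space_M)
  show "(\<lambda>x. x ^ k * exp (- t * x)) \<in> borel_measurable M"
    by (rule borel_measurable_M) simp
qed

lemma laplace_moment_nonneg: "0 \<le> laplace_moment M k t"
  unfolding laplace_moment_def by (intro Bochner_Integration.integral_nonneg) (auto simp: space_M)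

text \<open>The second-order error of the exponential is controlled by the moment of order \<open>k + 2\<close> at \<open>t/2\<close>, which is
finite, so the difference quotient is within a multiple of \<open>\<bar>h\<bar>\<close> of the asserted derivative.\<close>

lemma laplace_moment_has_derivative:
  assumes t: "0 < t"
  shows "(laplace_moment M k has_real_derivative - laplace_moment M (Suc k) t) (at t)"
proof -
  let ?C = "laplace_moment M (k + 2) (t / 2)"
  have "norm ((laplace_moment M k (t + h) - laplace_moment M k t) / h - - laplace_moment M (Suc k) t) \<le> \<bar>h\<bar> * ?C"
    if h: "h \<noteq> 0" "\<bar>h\<bar> < t / 2" for h
  proof -
    have th: "0 < t + h" using h t by linarith
    have pw: "\<bar>x ^ k * exp (- (t + h) * x) - x ^ k * exp (- t * x) + h * (x ^ Suc k * exp (- t * x))\<bar>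
        \<le> h\<^sup>2 * (x ^ (k + 2) * exp (- (t / 2) * x))" if x: "0 \<le> x" for x
    proof -
      have "x ^ k * exp (- (t + h) * x) - x ^ k * exp (- t * x) + h * (x ^ Suc k * exp (- t * x))
        = x ^ k * exp (- t * x) * (exp (- h * x) - 1 - (- h * x))"
      proof -
        have "exp (- (t + h) * x) = exp (- t * x) * exp (- h * x)"
          by (simp add: algebra_simps flip: exp_add)
        then show ?thesis by (simp only:) (simp add: algebra_simps)
      qed
      also have "\<bar>\<dots>\<bar> \<le> x ^ k * exp (- t * x) * ((- h * x)\<^sup>2 * exp \<bar>- h * x\<bar>)"
        using exp_second_order_bound[of "- h * x"] x by (simp add: abs_mult mult_left_mono)
      also have "\<dots> = h\<^sup>2 * (x ^ (k + 2) * exp (- t * x + \<bar>h\<bar> * x))"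
      proof -
        have "exp (- t * x + \<bar>h\<bar> * x) = exp (- t * x) * exp \<bar>- h * x\<bar>"
          using x by (simp add: abs_mult flip: exp_add)
        then show ?thesis by (simp only:) (simp add: power2_eq_square power_add)
      qed
      also have "\<dots> \<le> h\<^sup>2 * (x ^ (k + 2) * exp (- (t / 2) * x))"
      proof -
        have "\<bar>h\<bar> * x \<le> t / 2 * x" using h x by (intro mult_right_mono) auto
        then show ?thesis using x by (intro mult_left_mono) auto
      qed
      finally show ?thesis .
    qed
    have int: "integrable M (\<lambda>x. x ^ k * exp (- (t + h) * x))" "integrable M (\<lambda>x. x ^ k * exp (- t * x))"
       "integrable M (\<lambda>x. x ^ Suc k * exp (- t * x))" "integrable M (\<lambda>x. x ^ (k + 2) * exp (- (t / 2) * x))"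
      using t by (intro integrable_power_exp th; simp)+
    have "\<bar>laplace_moment M k (t + h) - laplace_moment M k t + h * laplace_moment M (Suc k) t\<bar>
       = \<bar>\<integral>x. x ^ k * exp (- (t + h) * x) - x ^ k * exp (- t * x) + h * (x ^ Suc k * exp (- t * x)) \<partial>M\<bar>"
      unfolding laplace_moment_def using int by simp
    also have "\<dots> \<le> (\<integral>x. h\<^sup>2 * (x ^ (k + 2) * exp (- (t / 2) * x)) \<partial>M)"
      using int pw by (intro integral_abs_bound_integral) (auto simp: space_M simp del: power_Suc)
    also have "\<dots> = h\<^sup>2 * ?C"
      unfolding laplace_moment_def by simp
    finally have *: "\<bar>laplace_moment M k (t + h) - laplace_moment M k t + h * laplace_moment M (Suc k) t\<bar> \<le> h\<^sup>2 * ?C" .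
    have "(laplace_moment M k (t + h) - laplace_moment M k t) / h - - laplace_moment M (Suc k) t
       = (laplace_moment M k (t + h) - laplace_moment M k t + h * laplace_moment M (Suc k) t) / h"
      using h by (simp add: field_simps)
    also have "norm \<dots> \<le> h\<^sup>2 * ?C / \<bar>h\<bar>"
      using * h by (simp add: divide_right_mono)
    also have "\<dots> = \<bar>h\<bar> * ?C"
      using h by (simp add: power2_eq_square field_simps)
    finally show ?thesis .
  qed
  moreover have "\<forall>\<^sub>F h in at 0. h \<noteq> 0 \<and> \<bar>h\<bar> < t / 2"
    using t by (auto simp: eventually_at intro!: exI[of _ "t/2"])
  ultimately have "\<forall>\<^sub>F h in at 0. norm ((laplace_moment M k (t + h) - laplace_moment M k t) / h - - laplace_moment M (Suc k) t) \<le> \<bar>h\<bar> * ?C"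
    by (auto elim!: eventually_mono)
  moreover have "((\<lambda>h. \<bar>h\<bar> * ?C) \<longlongrightarrow> \<bar>0\<bar> * ?C) (at 0)"
    by (intro tendsto_intros)
  then have "((\<lambda>h. \<bar>h\<bar> * ?C) \<longlongrightarrow> 0) (at 0)" by simp
  ultimately have "((\<lambda>h. (laplace_moment M k (t + h) - laplace_moment M k t) / h - - laplace_moment M (Suc k) t) \<longlongrightarrow> 0) (at 0)"
    by (rule Lim_null_comparison)
  then show ?thesis
    unfolding DERIV_def by (rule LIM_zero_cancel)
qed

lemma higher_deriv_laplace_transform:
  assumes "0 < t"
  shows "(deriv ^^ k) (laplace_transform M) t = (- 1) ^ k * laplace_moment M k t"
  using assms
proof (induction k arbitrary: t)
  case 0
  then show ?case by (simp add: laplace_transform_def laplace_moment_def)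
next
  case (Suc k)
  have "((deriv ^^ k) (laplace_transform M) has_real_derivative (- 1) ^ k * (- laplace_moment M (Suc k) t)) (at t)"
  proof (rule has_field_derivative_transform_within_open)
    show "((\<lambda>t. (- 1) ^ k * laplace_moment M k t) has_real_derivative (- 1) ^ k * (- laplace_moment M (Suc k) t)) (at t)"
      by (intro DERIV_cmult laplace_moment_has_derivative Suc.prems)
    show "open {0::real<..}" "t \<in> {0<..}" using Suc.prems by auto
  qed (use Suc.IH in auto)
  then show ?case by (simp add: DERIV_imp_deriv)
qed

text \<open>A vanishing moment would force \<open>x\<^sup>k\<close> to vanish almost everywhere, leaving no mass on the positive half-line.\<close>

lemma laplace_moment_pos:
  assumes t: "0 < t" and M: "emeasure M {0<..} \<noteq> 0"
  shows "0 < laplace_moment M k t"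
proof -
  have "laplace_moment M k t \<noteq> 0"
  proof
    assume "laplace_moment M k t = 0"
    then have "AE x in M. x ^ k * exp (- t * x) = 0"
      unfolding laplace_moment_def
      using integrable_power_exp[OF t] by (subst (asm) integral_nonneg_eq_0_iff_AE) (auto simp: space_M)
    then have "AE x in M. \<not> 0 < x" by eventually_elim auto
    moreover have "{x \<in> space M. \<not> \<not> 0 < x} = {0<..}" by (auto simp: space_M)
    moreover have "{0::real<..} \<in> sets M" by (auto simp: sets_M_iff)
    ultimately have "emeasure M {0<..} = 0" using AE_iff_measurable[of "{0<..}" M "\<lambda>x. \<not> 0 < x"] by simp
    then show False using M by simp
  qed
  with laplace_moment_nonneg show ?thesis by (simp add: order_less_le)
qed

end

section \<open>Convexity as an inequality between consecutive moments\<close>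

text \<open>The direction from convexity goes through monotonicity of the first derivative, obtained by comparing the tangents
at two points.\<close>

lemma convex_on_iff_deriv2_nonneg:
  fixes f f' f'' :: "real \<Rightarrow> real"
  assumes f': "\<And>x. 0 < x \<Longrightarrow> (f has_real_derivative f' x) (at x)"
    and f'': "\<And>x. 0 < x \<Longrightarrow> (f' has_real_derivative f'' x) (at x)"
  shows "convex_on {0<..} f \<longleftrightarrow> (\<forall>x>0. 0 \<le> f'' x)"
proof
  assume "\<forall>x>0. 0 \<le> f'' x"
  then show "convex_on {0<..} f"
    by (intro f''_ge0_imp_convex[OF _ f' f'']) auto
next
  assume cvx: "convex_on {0<..} f"
  have mono: "f' x \<le> f' y" if "0 < x" "x < y" for x y
  proof -
    have "f y - f x \<ge> f' x * (y - x)" "f x - f y \<ge> f' y * (x - y)"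
      using that by (auto intro!: convex_on_imp_above_tangent[OF cvx] has_field_derivative_at_within[OF f'] simp: interior_open)
    then have "(f' y - f' x) * (y - x) \<ge> 0" by (simp add: algebra_simps)
    then show ?thesis using that by (simp add: zero_le_mult_iff)
  qed
  show "\<forall>x>0. 0 \<le> f'' x"
  proof (intro allI impI)
    fix x :: real assume x: "0 < x"
    show "0 \<le> f'' x"
    proof (rule ccontr)
      assume "\<not> 0 \<le> f'' x"
      then obtain d where d: "d > 0" "\<And>h. 0 < h \<Longrightarrow> h < d \<Longrightarrow> f' (x + h) < f' x"
        using DERIV_neg_dec_right[OF f''[OF x]] by auto
      show False using d(2)[of "d/2"] d(1) mono[of x "x + d/2"] x by simp
    qed
  qed
qed

lemma ereal_convex_on_cong:
  assumes "\<And>x. x \<in> S \<Longrightarrow> f x = g x"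
  shows "ereal_convex_on S f \<longleftrightarrow> ereal_convex_on S g"
proof (cases "convex S")
  case True
  then have "f (u * x + v * y) = g (u * x + v * y)"
    if "x \<in> S" "y \<in> S" "0 \<le> u" "0 \<le> v" "u + v = 1" for x y u v
    using assms convexD[OF True that] by simp
  then show ?thesis
    unfolding ereal_convex_on_def by (simp add: assms)
qed (simp add: ereal_convex_on_def)

context half_line_measure
begin

text \<open>With \<open>m\<^sub>k' = - m\<^bsub>k+1\<^esub>\<close> the second derivative of \<open>m\<^bsub>n-1\<^esub>\<close> to the power \<open>-1/n\<close> is a positive multiple of
\<open>(1 + 1/n) m\<^sub>n\<^sup>2 - m\<^bsub>n-1\<^esub> m\<^bsub>n+1\<^esub>\<close>.\<close>

lemma neg_root_convex_iff_moment_inequality: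
  assumes M: "emeasure M {0<..} \<noteq> 0" and n: "1 \<le> n"
  shows "ereal_convex_on {0<..} (\<lambda>t. neg_root n \<bar>(deriv ^^ (n - 1)) (laplace_transform M) t\<bar>) \<longleftrightarrow>
    (\<forall>t>0. real n * laplace_moment M (n - 1) t * laplace_moment M (n + 1) t \<le> (real n + 1) * (laplace_moment M n t)\<^sup>2)"
proof -
  define m where "m = laplace_moment M"
  have pos: "0 < m k t" if "0 < t" for k t
    using laplace_moment_pos[OF that M] by (simp add: m_def)
  define f f' f'' where "f t = m (n - 1) t powr (- 1 / n)"
    and "f' t = 1 / n * m n t * m (n - 1) t powr (- 1 / n - 1)"
    and "f'' t = 1 / n * m (n - 1) t powr (- 1 / n - 2) * ((1 + 1 / n) * (m n t)\<^sup>2 - m (n - 1) t * m (n + 1) t)" for t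
  have m': "(m k has_real_derivative - m (Suc k) t) (at t)" if "0 < t" for k t
    unfolding m_def by (rule laplace_moment_has_derivative[OF that])
  have "(f has_real_derivative f' t) (at t)" if "0 < t" for t
    unfolding f_def f'_def using pos[OF that, of "n - 1"] n
    by (auto intro!: derivative_eq_intros m'[OF that] simp: powr_diff)
  moreover have "(f' has_real_derivative f'' t) (at t)" if "0 < t" for t
  proof -
    define a where "a = - 1 / real n - 2"
    have a: "- 1 / real n - 1 = a + 1"
      by (simp add: a_def)
    have "((\<lambda>t. 1 / n * m n t * m (n - 1) t powr (a + 1)) has_real_derivative
       1 / n * (- m (Suc n) t) * m (n - 1) t powr (a + 1) +
       1 / n * m n t * ((a + 1) * m (n - 1) t powr a * (- m (Suc (n - 1)) t))) (at t)"
      using pos[OF that, of "n - 1"] n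
      by (auto intro!: derivative_eq_intros m'[OF that] simp: field_simps)
    also have "1 / n * (- m (Suc n) t) * m (n - 1) t powr (a + 1) +
       1 / n * m n t * ((a + 1) * m (n - 1) t powr a * (- m (Suc (n - 1)) t)) = f'' t"
    proof -
      define b where "b = m (n - 1) t powr a"
      have "m (n - 1) t powr (a + 1) = b * m (n - 1) t"
        using pos[OF that, of "n - 1"] by (simp add: b_def powr_add)
      moreover have "f'' t = 1 / n * b * ((1 + 1 / n) * (m n t)\<^sup>2 - m (n - 1) t * m (n + 1) t)"
        by (simp add: f''_def b_def a_def)
      ultimately show ?thesis
        using n unfolding b_def[symmetric] by (simp only:) (simp add: a_def field_simps power2_eq_square)
    qed
    finally show ?thesis unfolding f'_def a .
  qed
  ultimately have "convex_on {0<..} f \<longleftrightarrow> (\<forall>t>0. 0 \<le> f'' t)"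
    by (rule convex_on_iff_deriv2_nonneg)
  also have "\<dots> \<longleftrightarrow> (\<forall>t>0. real n * m (n - 1) t * m (n + 1) t \<le> (real n + 1) * (m n t)\<^sup>2)"
  proof (intro all_cong imp_cong refl)
    fix t :: real assume t: "0 < t"
    have "0 \<le> f'' t \<longleftrightarrow> 0 \<le> (1 + 1 / n) * (m n t)\<^sup>2 - m (n - 1) t * m (n + 1) t"
    proof -
      have "0 < 1 / n * m (n - 1) t powr (- 1 / n - 2)"
        using pos[OF t, of "n - 1"] n by simp
      then show ?thesis
        unfolding f''_def by (simp only: zero_le_mult_iff) auto
    qed
    also have "\<dots> \<longleftrightarrow> real n * m (n - 1) t * m (n + 1) t \<le> (real n + 1) * (m n t)\<^sup>2"
      using n by (simp add: field_simps)
    finally show "0 \<le> f'' t \<longleftrightarrow> real n * m (n - 1) t * m (n + 1) t \<le> (real n + 1) * (m n t)\<^sup>2" .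
  qed
  also have "convex_on {0<..} f \<longleftrightarrow> ereal_convex_on {0<..} (\<lambda>t. neg_root n \<bar>(deriv ^^ (n - 1)) (laplace_transform M) t\<bar>)"
  proof -
    have eq: "neg_root n \<bar>(deriv ^^ (n - 1)) (laplace_transform M) t\<bar> = ereal (f t)" if "0 < t" for t
      using pos[OF that, of "n - 1"]
      by (simp add: higher_deriv_laplace_transform[OF that] neg_root_def f_def m_def abs_mult power_abs)
    have "ereal_convex_on {0<..} (\<lambda>t. neg_root n \<bar>(deriv ^^ (n - 1)) (laplace_transform M) t\<bar>)
        \<longleftrightarrow> ereal_convex_on {0<..} (\<lambda>t. ereal (f t))"
      by (rule ereal_convex_on_cong) (simp only: eq greaterThan_iff)
    then show ?thesis by (simp add: ereal_convex_on_ereal_iff)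
  qed
  finally show ?thesis by (simp add: m_def)
qed

end

section \<open>Moments of a log-concave density\<close>

text \<open>If \<open>u\<close> divides the segment from \<open>x\<close> to \<open>y\<close> with weights \<open>a\<close> and \<open>1 - a\<close>, then the reflected point
\<open>x + y - u\<close> divides it with the weights interchanged, and the two log-concavity bounds multiply to
\<open>f x * f y\<close>.\<close>

lemma log_concave_fun_exchange:
  assumes f: "log_concave_fun f" and x: "0 \<le> x" "x \<le> u" "u \<le> y"
  shows "f x * f y \<le> f u * f (x + y - u)"
proof (cases "x = u \<or> u = y")
  case False
  define a where "a = (y - u) / (y - x)"
  have xy: "x < y" using False x by auto
  have a: "0 < a" "a < 1" using False x by (auto simp: a_def)
  have "a * (y - x) = y - u" using xy by (simp add: a_def)
  then have u: "u = a * x + (1 - a) * y" "x + y - u = (1 - a) * x + (1 - (1 - a)) * y"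
    by (simp_all add: algebra_simps)
  have nonneg: "0 \<le> f x" "0 \<le> f y" using f x by (auto simp: log_concave_fun_def)
  have lc: "f x powr b * f y powr (1 - b) \<le> f (b * x + (1 - b) * y)" if "0 < b" "b < 1" for b
    using f x that by (auto simp: log_concave_fun_def)
  have "f x * f y = (f x powr a * f x powr (1 - a)) * (f y powr (1 - a) * f y powr (1 - (1 - a)))"
    using nonneg by (simp flip: powr_add)
  also have "\<dots> = (f x powr a * f y powr (1 - a)) * (f x powr (1 - a) * f y powr (1 - (1 - a)))"
    by (simp add: mult_ac)
  also have "\<dots> \<le> f u * f (x + y - u)"
    unfolding u(2) using lc[of a] lc[of "1 - a"] a u(1)
    by (intro mult_mono) (auto intro: order_trans[OF _ lc])
  finally show ?thesis .
qed auto

text \<open>For constant \<open>\<rho>\<close> both sides agree, being multiples of values of the beta function.  Averaging the integrand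
with its reflection gives \<open>\<rho>\<close> times the polynomial \<open>q\<close> of the proof, which is the derivative of
\<open>2 (x (s - x))\<^sup>n (x - s/2)\<close> and so has integral zero over the interval.  It is nonnegative where
\<open>\<bar>x - s/2\<bar> \<le> v\<close>, and there \<open>\<rho>\<close> is at least its value at distance \<open>v\<close> from the centre; in the rest of
the interval both relations are reversed.  Hence \<open>q\<close> times the excess of \<open>\<rho>\<close> over that value is nonnegative everywhere.\<close>

lemma symmetric_unimodal_beta_inequality:
  fixes \<rho> :: "real \<Rightarrow> real"
  assumes s: "0 \<le> s" and n: "1 \<le> n"
    and meas [measurable]: "\<rho> \<in> borel_measurable borel"
    and nonneg: "\<And>x. 0 \<le> \<rho> x"
    and sym: "\<And>x. \<rho> (s - x) = \<rho> x"
    and mono: "\<And>x y. 0 \<le> x \<Longrightarrow> x \<le> y \<Longrightarrow> y \<le> s / 2 \<Longrightarrow> \<rho> x \<le> \<rho> y"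
  defines "J \<equiv> \<lambda>a b. \<integral>x. indicator {0..s} x * (x ^ a * (s - x) ^ b * \<rho> x) \<partial>lborel"
  shows "integrable lborel (\<lambda>x. indicator {0..s} x * (x ^ a * (s - x) ^ b * \<rho> x))"
    and "real n * J (n - 1) (n + 1) \<le> (real n + 1) * J n n"
proof -
  have fold: "\<rho> x = \<rho> (s / 2 - \<bar>x - s / 2\<bar>)" for x
  proof (cases "x < s / 2")
    case False
    then have "s / 2 - \<bar>x - s / 2\<bar> = s - x" by simp
    then show ?thesis using sym[of x] by simp
  qed simp
  have bound: "\<rho> x \<le> \<rho> (s / 2)" if "x \<in> {0..s}" for x
    unfolding fold[of x] using that by (intro mono) (auto simp: abs_if)
  show int: "integrable lborel (\<lambda>x. indicator {0..s} x * (x ^ a * (s - x) ^ b * \<rho> x))" for a b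
  proof (rule Bochner_Integration.integrable_bound)
    show "integrable lborel (\<lambda>x. s ^ a * s ^ b * \<rho> (s / 2) * indicator {0..s} x)"
      using s by (intro integrable_mult_right integrable_real_indicator) auto
    show "AE x in lborel. norm (indicator {0..s} x * (x ^ a * (s - x) ^ b * \<rho> x)) \<le>
       norm (s ^ a * s ^ b * \<rho> (s / 2) * indicator {0..s} x)"
      using s nonneg bound
      by (intro AE_I2) (auto simp: indicator_def abs_mult intro!: mult_mono power_mono)
  qed measurable
  have refl: "J a b = J b a" for a b
  proof -
    have "J a b = (\<integral>x. indicator {0..s} (s + (-1) * x) * ((s + (-1) * x) ^ a * (s - (s + (-1) * x)) ^ b * \<rho> (s + (-1) * x)) \<partial>lborel)"
      unfolding J_def by (subst lborel_integral_real_affine[where c = "-1" and t = s]) simp_all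
    also have "\<dots> = J b a"
      unfolding J_def by (intro Bochner_Integration.integral_cong) (auto simp: indicator_def sym)
    finally show ?thesis .
  qed
  \<comment> \<open>The distance from the centre at which the symmetrised polynomial \<open>q\<close> changes sign.\<close>
  define v where "v = s / (2 * sqrt (2 * real n + 1))"
  define q where "q x = 2 * (x * (s - x)) ^ (n - 1) * (s\<^sup>2 / 4 - (2 * real n + 1) * (x - s / 2)\<^sup>2)" for x
  have v2: "(2 * real n + 1) * v\<^sup>2 = s\<^sup>2 / 4" and v: "0 \<le> v" "v \<le> s / 2"
  proof -
    have "v\<^sup>2 = s\<^sup>2 / (4 * (2 * real n + 1))"
      by (simp add: v_def power_divide power_mult_distrib)
    then show "(2 * real n + 1) * v\<^sup>2 = s\<^sup>2 / 4"
      by (simp add: field_simps)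
    show "0 \<le> v" using s by (simp add: v_def)
    have "1 \<le> sqrt (2 * real n + 1)" by simp
    then show "v \<le> s / 2"
      unfolding v_def using s by (intro divide_left_mono) auto
  qed
  have q_eq: "q x = 2 * (real n + 1) * (x ^ n * (s - x) ^ n) - real n * (x ^ (n - 1) * (s - x) ^ (n + 1))
      - real n * (x ^ (n + 1) * (s - x) ^ (n - 1))" for x
  proof -
    have p: "z ^ n = z ^ (n - 1) * z" "z ^ (n + 1) = z ^ (n - 1) * z\<^sup>2" for z :: real
      using n by (cases n; simp add: power2_eq_square)+
    show ?thesis
      unfolding q_def p power_mult_distrib by (simp add: power2_eq_square field_simps)
  qed
  have q_integral: "(\<integral>x. q x * indicator {0..s} x \<partial>lborel) = 0" and q_int: "integrable lborel (\<lambda>x. q x * indicator {0..s} x)"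
  proof -
    have "((\<lambda>x. 2 * (x * (s - x)) ^ n * (x - s / 2)) has_real_derivative q x) (at x)" for x
    proof -
      have "(x * (s - x)) ^ n = (x * (s - x)) ^ (n - 1) * (x * (s - x))"
        using n by (cases n) auto
      then show ?thesis
        unfolding q_def
        by (auto intro!: derivative_eq_intros) (simp add: power2_eq_square field_simps)
    qed
    then have "has_bochner_integral lborel (\<lambda>x. q x * indicator {0..s} x)
       (2 * (s * (s - s)) ^ n * (s - s / 2) - 2 * (0 * (s - 0)) ^ n * (0 - s / 2))"
    proof (rule has_bochner_integral_FTC_Icc_real[OF s])
      show "isCont q x" for x unfolding q_def[abs_def] by (intro continuous_intros)
    qed
    then have *: "has_bochner_integral lborel (\<lambda>x. q x * indicator {0..s} x) 0"
      using n by (cases n) auto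
    show "(\<integral>x. q x * indicator {0..s} x \<partial>lborel) = 0"
      using * by (rule has_bochner_integral_integral_eq)
    show "integrable lborel (\<lambda>x. q x * indicator {0..s} x)"
      using * by (rule integrable.intros)
  qed
  have pw: "0 \<le> q x * (\<rho> x - \<rho> (s / 2 - v))" if x: "x \<in> {0..s}" for x
  proof (cases "\<bar>x - s / 2\<bar> \<le> v")
    case True
    then have "(x - s / 2)\<^sup>2 \<le> v\<^sup>2" using abs_le_square_iff[of "x - s / 2" v] v by simp
    then have "(2 * real n + 1) * (x - s / 2)\<^sup>2 \<le> (2 * real n + 1) * v\<^sup>2" by (intro mult_left_mono) auto
    then have "0 \<le> q x" unfolding q_def v2 using x by auto
    moreover have "\<rho> (s / 2 - v) \<le> \<rho> x"
      unfolding fold[of x] using True v by (intro mono) auto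
    ultimately show ?thesis by simp
  next
    case False
    then have "v\<^sup>2 \<le> (x - s / 2)\<^sup>2" using abs_le_square_iff[of v "x - s / 2"] v by simp
    then have "(2 * real n + 1) * v\<^sup>2 \<le> (2 * real n + 1) * (x - s / 2)\<^sup>2" by (intro mult_left_mono) auto
    then have "q x \<le> 0" unfolding q_def v2 using x by (intro mult_nonneg_nonpos) auto
    moreover have "\<rho> x \<le> \<rho> (s / 2 - v)"
      unfolding fold[of x] using False v x by (intro mono) (auto simp: abs_if)
    ultimately show ?thesis by (intro mult_nonpos_nonpos) auto
  qed
  have "0 \<le> (\<integral>x. indicator {0..s} x * (q x * (\<rho> x - \<rho> (s / 2 - v))) \<partial>lborel)"
    using pw by (intro Bochner_Integration.integral_nonneg) (auto simp: indicator_def)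
  also have "\<dots> = (\<integral>x. 2 * (real n + 1) * (indicator {0..s} x * (x ^ n * (s - x) ^ n * \<rho> x))
      - real n * (indicator {0..s} x * (x ^ (n - 1) * (s - x) ^ (n + 1) * \<rho> x))
      - real n * (indicator {0..s} x * (x ^ (n + 1) * (s - x) ^ (n - 1) * \<rho> x))
      - \<rho> (s / 2 - v) * (q x * indicator {0..s} x) \<partial>lborel)"
  proof (intro Bochner_Integration.integral_cong refl)
    fix x
    have "q x * (\<rho> x - \<rho> (s / 2 - v)) = q x * \<rho> x - \<rho> (s / 2 - v) * q x"
      by (simp add: algebra_simps)
    also have "q x * \<rho> x = 2 * (real n + 1) * (x ^ n * (s - x) ^ n * \<rho> x)
      - real n * (x ^ (n - 1) * (s - x) ^ (n + 1) * \<rho> x) - real n * (x ^ (n + 1) * (s - x) ^ (n - 1) * \<rho> x)"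
      by (simp only: q_eq left_diff_distrib mult.assoc)
    finally show "indicator {0..s} x * (q x * (\<rho> x - \<rho> (s / 2 - v))) =
        2 * (real n + 1) * (indicator {0..s} x * (x ^ n * (s - x) ^ n * \<rho> x))
      - real n * (indicator {0..s} x * (x ^ (n - 1) * (s - x) ^ (n + 1) * \<rho> x))
      - real n * (indicator {0..s} x * (x ^ (n + 1) * (s - x) ^ (n - 1) * \<rho> x))
      - \<rho> (s / 2 - v) * (q x * indicator {0..s} x)"
      by (simp split: split_indicator)
  qed simp
  also have "\<dots> = 2 * (real n + 1) * J n n - real n * J (n - 1) (n + 1) - real n * J (n + 1) (n - 1)"
  proof -
    define R where "R a b x = indicator {0..s} x * (x ^ a * (s - x) ^ b * \<rho> x)" for a b x
    have "integrable lborel (R a b)" "J a b = integral\<^sup>L lborel (R a b)" for a b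
      using int by (simp_all add: R_def[abs_def] J_def)
    then show ?thesis
      unfolding R_def[symmetric] using q_int q_integral by simp
  qed
  finally show "real n * J (n - 1) (n + 1) \<le> (real n + 1) * J n n"
    using refl[of "n + 1" "n - 1"] by (simp add: algebra_simps)
qed

text \<open>Tonelli's theorem after the substitution \<open>s = x + y\<close>, which slices the quadrant into the segments on which the
log-concavity of the density can be used.\<close>

lemma moment_product_as_convolution:
  fixes g :: "real \<Rightarrow> real"
  assumes [measurable]: "g \<in> borel_measurable borel"
    and nonneg: "\<And>x. 0 \<le> g x" and supp: "\<And>x. x < 0 \<Longrightarrow> g x = 0"
  defines "I \<equiv> \<lambda>k. \<integral>\<^sup>+x. ennreal (x ^ k * g x) \<partial>lborel"
  shows "I a * I b = (\<integral>\<^sup>+s. \<integral>\<^sup>+x. ennreal (indicator {0..s} x * (x ^ a * (s - x) ^ b * (g x * g (s - x)))) \<partial>lborel \<partial>lborel)"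
proof -
  have "I a * I b = (\<integral>\<^sup>+x. ennreal (x ^ a * g x) * I b \<partial>lborel)"
    unfolding I_def by (subst nn_integral_multc) auto
  also have "\<dots> = (\<integral>\<^sup>+x. \<integral>\<^sup>+s. ennreal (x ^ a * g x) * ennreal ((s - x) ^ b * g (s - x)) \<partial>lborel \<partial>lborel)"
  proof (intro nn_integral_cong)
    fix x :: real
    have "I b = (\<integral>\<^sup>+s. ennreal ((s - x) ^ b * g (s - x)) \<partial>lborel)"
      unfolding I_def by (subst nn_integral_real_affine[where c = 1 and t = "- x"]) (auto simp: add.commute)
    then show "ennreal (x ^ a * g x) * I b = (\<integral>\<^sup>+s. ennreal (x ^ a * g x) * ennreal ((s - x) ^ b * g (s - x)) \<partial>lborel)"
      by (subst nn_integral_cmult) auto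
  qed
  also have "\<dots> = (\<integral>\<^sup>+s. \<integral>\<^sup>+x. ennreal (x ^ a * g x) * ennreal ((s - x) ^ b * g (s - x)) \<partial>lborel \<partial>lborel)"
    by (rule lborel_pair.Fubini') measurable
  also have "\<dots> = (\<integral>\<^sup>+s. \<integral>\<^sup>+x. ennreal (indicator {0..s} x * (x ^ a * (s - x) ^ b * (g x * g (s - x)))) \<partial>lborel \<partial>lborel)"
  proof (intro nn_integral_cong)
    fix s x :: real
    show "ennreal (x ^ a * g x) * ennreal ((s - x) ^ b * g (s - x)) =
        ennreal (indicator {0..s} x * (x ^ a * (s - x) ^ b * (g x * g (s - x))))"
      using supp[of x] supp[of "s - x"] nonneg[of x] nonneg[of "s - x"]
      by (cases "x \<in> {0..s}") (auto simp: mult_ac simp flip: ennreal_mult)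
  qed
  finally show ?thesis .
qed

text \<open>The inequality holds already on each slice \<open>x + y = s\<close>.  Nonnegative integrals spare any discussion of
integrability in the plane.\<close>

lemma log_concave_moment_inequality:
  fixes g :: "real \<Rightarrow> real"
  assumes [measurable]: "g \<in> borel_measurable borel"
    and nonneg: "\<And>x. 0 \<le> g x" and supp: "\<And>x. x < 0 \<Longrightarrow> g x = 0"
    and exchange: "\<And>x u y. 0 \<le> x \<Longrightarrow> x \<le> u \<Longrightarrow> u \<le> y \<Longrightarrow> g x * g y \<le> g u * g (x + y - u)"
    and n: "1 \<le> n"
  defines "I \<equiv> \<lambda>k. \<integral>\<^sup>+x. ennreal (x ^ k * g x) \<partial>lborel"
  shows "of_nat n * (I (n - 1) * I (n + 1)) \<le> (of_nat n + 1) * (I n * I n)"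
proof -
  define K where "K a b s = (\<integral>\<^sup>+x. ennreal (indicator {0..s} x * (x ^ a * (s - x) ^ b * (g x * g (s - x)))) \<partial>lborel)" for a b s
  have [measurable]: "K a b \<in> borel_measurable lborel" for a b
    unfolding K_def[abs_def] indicator_def atLeastAtMost_iff by measurable
  have "of_nat n * K (n - 1) (n + 1) s \<le> (of_nat n + 1) * K n n s" for s
  proof (cases "0 \<le> s")
    case True
    define \<rho> where "\<rho> x = g x * g (s - x)" for x
    have "\<rho> x \<le> \<rho> y" if "0 \<le> x" "x \<le> y" "y \<le> s / 2" for x y
      using exchange[of x y "s - x"] that by (simp add: \<rho>_def)
    then have *: "\<rho> \<in> borel_measurable borel" "\<And>x. 0 \<le> \<rho> x" "\<And>x. \<rho> (s - x) = \<rho> x"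
      "\<And>x y. 0 \<le> x \<Longrightarrow> x \<le> y \<Longrightarrow> y \<le> s / 2 \<Longrightarrow> \<rho> x \<le> \<rho> y"
      unfolding \<rho>_def[abs_def] using nonneg by (auto simp: mult.commute)
    have K: "K a b s = ennreal (\<integral>x. indicator {0..s} x * (x ^ a * (s - x) ^ b * \<rho> x) \<partial>lborel)" for a b
      unfolding K_def \<rho>_def[symmetric]
      by (intro nn_integral_eq_integral symmetric_unimodal_beta_inequality(1)[where \<rho>=\<rho>, OF True n *])
        (auto simp: indicator_def *)
    show ?thesis
      unfolding K
      using symmetric_unimodal_beta_inequality(2)[where \<rho>=\<rho>, OF True n *]
      by (auto simp: ennreal_of_nat_eq_real_of_nat simp flip: ennreal_mult' ennreal_1 ennreal_plus intro!: ennreal_leI)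
  next
    case False
    then have "K a b s = 0" for a b by (simp add: K_def)
    then show ?thesis by simp
  qed
  then have "(\<integral>\<^sup>+s. of_nat n * K (n - 1) (n + 1) s \<partial>lborel) \<le> (\<integral>\<^sup>+s. (of_nat n + 1) * K n n s \<partial>lborel)"
    by (intro nn_integral_mono)
  then have "of_nat n * (\<integral>\<^sup>+s. K (n - 1) (n + 1) s \<partial>lborel) \<le> (of_nat n + 1) * (\<integral>\<^sup>+s. K n n s \<partial>lborel)"
    by (simp add: nn_integral_cmult)
  moreover have "I a * I b = (\<integral>\<^sup>+s. K a b s \<partial>lborel)" for a b
    unfolding I_def K_def by (rule moment_product_as_convolution[OF assms(1-3)])
  ultimately show ?thesis by simp
qed

context half_line_measure
begin

lemma log_concave_density_imp_moment_inequality: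
  assumes f: "f \<in> borel_measurable borel_half_line" and lc: "log_concave_fun f"
    and M: "M = density (restrict_space lborel {0..}) (\<lambda>x. ennreal (f x))"
    and t: "0 < t" and n: "1 \<le> n"
  shows "real n * laplace_moment M (n - 1) t * laplace_moment M (n + 1) t \<le> (real n + 1) * (laplace_moment M n t)\<^sup>2"
proof -
  have f_nonneg: "0 \<le> f x" if "0 \<le> x" for x
    using lc that by (auto simp: log_concave_fun_def)
  define g where "g x = exp (- t * x) * (f x * indicator {0..} x)" for x
  have g: "g \<in> borel_measurable borel"
    using f unfolding g_def[abs_def]
    by (subst (asm) borel_measurable_restrict_space_iff) (auto simp: mult.commute)
  have moments: "(\<integral>\<^sup>+x. ennreal (x ^ k * g x) \<partial>lborel) = ennreal (laplace_moment M k t)" for k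
  proof -
    have "ennreal (laplace_moment M k t) = (\<integral>\<^sup>+x. ennreal (x ^ k * exp (- t * x)) \<partial>M)"
      unfolding laplace_moment_def
      by (intro nn_integral_eq_integral[symmetric] integrable_power_exp t) (auto simp: space_M)
    also have "\<dots> = (\<integral>\<^sup>+x. ennreal (f x) * ennreal (x ^ k * exp (- t * x)) \<partial>restrict_space lborel {0..})"
    proof -
      have "sets (restrict_space lborel {0..}) = sets borel_half_line"
        by (simp add: sets_restrict_space)
      then have "f \<in> borel_measurable (restrict_space lborel {0..})"
        using f measurable_cong_sets by blast
      then show ?thesis
        unfolding M by (subst nn_integral_density) (auto intro!: measurable_restrict_space1)
    qed
    also have "\<dots> = (\<integral>\<^sup>+x. ennreal (f x) * ennreal (x ^ k * exp (- t * x)) * indicator {0..} x \<partial>lborel)"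
      by (subst nn_integral_restrict_space) auto
    also have "\<dots> = (\<integral>\<^sup>+x. ennreal (x ^ k * g x) \<partial>lborel)"
      by (intro nn_integral_cong) (auto simp: g_def indicator_def f_nonneg mult_ac simp flip: ennreal_mult)
    finally show ?thesis by simp
  qed
  have "of_nat n * (ennreal (laplace_moment M (n - 1) t) * ennreal (laplace_moment M (n + 1) t))
      \<le> (of_nat n + 1) * (ennreal (laplace_moment M n t) * ennreal (laplace_moment M n t))"
    unfolding moments[symmetric]
  proof (rule log_concave_moment_inequality[OF g _ _ _ n])
    fix x u y :: real assume x: "0 \<le> x" "x \<le> u" "u \<le> y"
    have "exp (- t * x) * exp (- t * y) = exp (- t * u) * exp (- t * (x + y - u))"
      by (simp add: algebra_simps flip: exp_add)
    then have "g x * g y = exp (- t * u) * exp (- t * (x + y - u)) * (f x * f y)"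
      using x by (simp add: g_def)
    also have "\<dots> \<le> exp (- t * u) * exp (- t * (x + y - u)) * (f u * f (x + y - u))"
      by (intro mult_left_mono log_concave_fun_exchange lc x) auto
    also have "\<dots> = g u * g (x + y - u)"
      using x by (simp add: g_def)
    finally show "g x * g y \<le> g u * g (x + y - u)" .
  qed (auto simp: g_def f_nonneg indicator_def)
  then have "ennreal (real n * (laplace_moment M (n - 1) t * laplace_moment M (n + 1) t))
      \<le> ennreal ((real n + 1) * (laplace_moment M n t * laplace_moment M n t))"
    by (simp add: ennreal_of_nat_eq_real_of_nat laplace_moment_nonneg ennreal_mult)
  then show ?thesis
    by (subst (asm) ennreal_le_iff) (auto simp: laplace_moment_nonneg power2_eq_square mult.assoc)
qed

end

section \<open>Approximating a measure by its Poisson mixtures\<close>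

text \<open>The mass function of the Poisson distribution as an explicit formula, so that mean zero is included: the mean
will be \<open>t * x\<close> with \<open>x\<close> possibly \<open>0\<close>.\<close>

definition poisson_weight :: "real \<Rightarrow> nat \<Rightarrow> real" where
  "poisson_weight l n = l ^ n / fact n * exp (- l)"

lemma poisson_weight_nonneg: "0 \<le> l \<Longrightarrow> 0 \<le> poisson_weight l n"
  by (simp add: poisson_weight_def)

lemma poisson_weight_sums: "poisson_weight l sums 1"
proof -
  have "(\<lambda>n. l ^ n / fact n * exp (- l)) sums (exp l * exp (- l))"
    using exp_converges[of l] by (intro sums_mult2) (simp add: scaleR_conv_of_real divide_inverse mult.commute)
  then show ?thesis
    by (simp add: poisson_weight_def[abs_def] exp_minus)
qed

lemma poisson_weight_Suc: "real (Suc n) * poisson_weight l (Suc n) = l * poisson_weight l n"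
  by (simp add: poisson_weight_def divide_simps del: of_nat_Suc)

text \<open>Mean and second moment follow by shifting the index once, as \<open>n\<close> cancels against the factorial.\<close>

lemma poisson_weight_variance: "(\<lambda>n. (real n - l)\<^sup>2 * poisson_weight l n) sums l"
proof -
  have "(\<lambda>n. real (Suc n) * poisson_weight l (Suc n)) sums (l * 1)"
    unfolding poisson_weight_Suc by (intro sums_mult poisson_weight_sums)
  then have mean: "(\<lambda>n. real n * poisson_weight l n) sums l"
    by (subst (asm) sums_Suc_iff) simp
  have "(\<lambda>n. l * (real n * poisson_weight l n + poisson_weight l n)) sums (l * (l + 1))"
    by (intro sums_mult sums_add mean poisson_weight_sums)
  also have "(\<lambda>n. l * (real n * poisson_weight l n + poisson_weight l n))
      = (\<lambda>n. (real (Suc n))\<^sup>2 * poisson_weight l (Suc n))"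
  proof
    fix n
    have "(real (Suc n))\<^sup>2 * poisson_weight l (Suc n) = real (Suc n) * (l * poisson_weight l n)"
      unfolding power2_eq_square mult.assoc poisson_weight_Suc ..
    then show "l * (real n * poisson_weight l n + poisson_weight l n) = (real (Suc n))\<^sup>2 * poisson_weight l (Suc n)"
      by (simp add: algebra_simps)
  qed
  finally have second: "(\<lambda>n. (real n)\<^sup>2 * poisson_weight l n) sums (l * (l + 1))"
    by (subst (asm) sums_Suc_iff) simp
  have "(\<lambda>n. (real n)\<^sup>2 * poisson_weight l n - 2 * l * (real n * poisson_weight l n) + l\<^sup>2 * poisson_weight l n)
      sums (l * (l + 1) - 2 * l * l + l\<^sup>2 * 1)"
    by (intro sums_add sums_diff sums_mult mean second poisson_weight_sums)
  then show ?thesis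
    by (simp add: power2_eq_square algebra_simps)
qed

text \<open>Chebyshev's inequality.\<close>

lemma poisson_deviation:
  assumes l: "0 \<le> l" and e: "0 < e" and S: "finite S" "\<And>n. n \<in> S \<Longrightarrow> e \<le> \<bar>real n - l\<bar>"
  shows "(\<Sum>n\<in>S. poisson_weight l n) \<le> l / e\<^sup>2"
proof -
  have "e\<^sup>2 * (\<Sum>n\<in>S. poisson_weight l n) \<le> (\<Sum>n\<in>S. (real n - l)\<^sup>2 * poisson_weight l n)"
    unfolding sum_distrib_left
    using S e by (intro sum_mono mult_right_mono poisson_weight_nonneg l) (auto simp: abs_le_square_iff[symmetric])
  also have "\<dots> \<le> (\<Sum>n. (real n - l)\<^sup>2 * poisson_weight l n)"
    using poisson_weight_variance[of l] poisson_weight_nonneg[OF l]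
    by (intro sum_le_suminf S) (auto simp: sums_iff)
  also have "\<dots> = l"
    using poisson_weight_variance[of l] by (simp add: sums_iff)
  finally show ?thesis
    using e by (simp add: field_simps)
qed

lemma finite_nats_le: "finite {n::nat. real n \<le> c}"
  by (rule finite_subset[of _ "{..nat \<lfloor>c\<rfloor>}"]) (auto simp: le_nat_floor)

definition poisson_cdf :: "real \<Rightarrow> real \<Rightarrow> real" where
  "poisson_cdf l c = (\<Sum>n | real n \<le> c. poisson_weight l n)"

lemma poisson_cdf_nonneg: "0 \<le> l \<Longrightarrow> 0 \<le> poisson_cdf l c"
  unfolding poisson_cdf_def by (intro sum_nonneg poisson_weight_nonneg)

lemma poisson_cdf_le_1: "0 \<le> l \<Longrightarrow> poisson_cdf l c \<le> 1"
  unfolding poisson_cdf_def using poisson_weight_sums[of l] poisson_weight_nonneg[of l]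
  by (metis finite_nats_le sum_le_suminf sums_iff)

lemma poisson_cdf_upper:
  assumes "0 \<le> l" "c < l"
  shows "poisson_cdf l c \<le> l / (l - c)\<^sup>2"
  unfolding poisson_cdf_def using assms by (intro poisson_deviation finite_nats_le) auto

lemma poisson_cdf_lower:
  assumes l: "0 \<le> l" "l < c"
  shows "1 - l / (c - l)\<^sup>2 \<le> poisson_cdf l c"
proof -
  have "(\<Sum>n<N. poisson_weight l n) \<le> poisson_cdf l c + l / (c - l)\<^sup>2" for N
  proof -
    have "(\<Sum>n<N. poisson_weight l n) \<le> (\<Sum>n\<in>{n. real n \<le> c} \<union> {n. n < N \<and> c < real n}. poisson_weight l n)"
      using poisson_weight_nonneg[OF l(1)] by (intro sum_mono2) (auto simp: finite_nats_le)
    also have "\<dots> = poisson_cdf l c + (\<Sum>n | n < N \<and> c < real n. poisson_weight l n)"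
      unfolding poisson_cdf_def by (intro sum.union_disjoint) (auto simp: finite_nats_le)
    also have "(\<Sum>n | n < N \<and> c < real n. poisson_weight l n) \<le> l / (c - l)\<^sup>2"
      using l by (intro poisson_deviation) auto
    finally show ?thesis by simp
  qed
  then have "1 \<le> poisson_cdf l c + l / (c - l)\<^sup>2"
    using poisson_weight_sums[of l] unfolding sums_def by (intro LIMSEQ_le_const2) auto
  then show ?thesis by simp
qed

text \<open>At scale \<open>t\<close> the Poisson distribution of mean \<open>t x\<close> has standard deviation of order \<open>sqrt t\<close>, which is small
compared with the distance \<open>t \<bar>z - x\<bar>\<close> from the mean to the threshold.  At \<open>x = z > 0\<close> the limit is
one half instead.\<close>

lemma poisson_cdf_concentration:
  fixes t :: "nat \<Rightarrow> real"
  assumes t: "filterlim t at_top sequentially" and x: "0 \<le> x" "x \<noteq> z"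
  shows "(\<lambda>k. poisson_cdf (t k * x) (t k * z)) \<longlonglongrightarrow> indicator {..z} x"
proof -
  have lim0: "(\<lambda>k. x / (z - x)\<^sup>2 / t k) \<longlonglongrightarrow> 0"
    by (rule real_tendsto_divide_at_top[OF tendsto_const t])
  have pos: "\<forall>\<^sub>F k in sequentially. 0 < t k"
    using t by (rule filterlim_at_top_dense[THEN iffD1, rule_format])
  have eq: "(T * x) / (T * z - T * x)\<^sup>2 = x / (z - x)\<^sup>2 / T" if "0 < T" for T
  proof -
    have "(T * z - T * x)\<^sup>2 = T * T * (z - x)\<^sup>2" by (simp add: power2_eq_square algebra_simps)
    then show ?thesis using that by simp
  qed
  show ?thesis
  proof (cases "x < z")
    case True
    have "(\<lambda>k. poisson_cdf (t k * x) (t k * z)) \<longlonglongrightarrow> 1"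
    proof (rule tendsto_sandwich)
      show "\<forall>\<^sub>F k in sequentially. 1 - x / (z - x)\<^sup>2 / t k \<le> poisson_cdf (t k * x) (t k * z)"
        using pos
      proof eventually_elim
        case (elim k)
        have "1 - t k * x / (t k * z - t k * x)\<^sup>2 \<le> poisson_cdf (t k * x) (t k * z)"
          using elim x True by (intro poisson_cdf_lower) auto
        then show ?case unfolding eq[OF elim] .
      qed
      show "\<forall>\<^sub>F k in sequentially. poisson_cdf (t k * x) (t k * z) \<le> 1"
        using pos by eventually_elim (use x in \<open>auto intro!: poisson_cdf_le_1\<close>)
      show "(\<lambda>k. 1 - x / (z - x)\<^sup>2 / t k) \<longlonglongrightarrow> 1"
        using tendsto_diff[OF tendsto_const[of 1] lim0] by simp
    qed simp
    then show ?thesis using True by simp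
  next
    case False
    have "(\<lambda>k. poisson_cdf (t k * x) (t k * z)) \<longlonglongrightarrow> 0"
    proof (rule tendsto_sandwich)
      show "\<forall>\<^sub>F k in sequentially. 0 \<le> poisson_cdf (t k * x) (t k * z)"
        using pos by eventually_elim (use x in \<open>auto intro!: poisson_cdf_nonneg\<close>)
      show "\<forall>\<^sub>F k in sequentially. poisson_cdf (t k * x) (t k * z) \<le> x / (z - x)\<^sup>2 / t k"
        using pos
      proof eventually_elim
        case (elim k)
        have "poisson_cdf (t k * x) (t k * z) \<le> t k * x / (t k * x - t k * z)\<^sup>2"
          using elim x False by (intro poisson_cdf_upper) auto
        then show ?case unfolding eq[OF elim, symmetric] by (simp add: power2_commute)
      qed
    qed (use lim0 in simp_all)
    then show ?thesis using False x by simp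
  qed
qed

text \<open>The ratios of consecutive terms decrease, so moving \<open>d\<close> steps up from \<open>i\<close> multiplies by at least as much as
moving \<open>d\<close> steps up from \<open>j\<close>.\<close>

lemma log_concave_sequence_exchange:
  fixes a :: "nat \<Rightarrow> real"
  assumes pos: "\<And>n. 0 < a n" and lc: "\<And>n. a n * a (n + 2) \<le> (a (n + 1))\<^sup>2" and ij: "i \<le> j"
  shows "a i * a (j + d) \<le> a (i + d) * a j"
proof (induction d)
  case (Suc d)
  have step: "a (Suc n) / a n \<le> a (Suc m) / a m" if "m \<le> n" for m n
    using that
  proof (induction n rule: dec_induct)
    case (step n)
    have "a (Suc (Suc n)) / a (Suc n) \<le> a (Suc n) / a n"
      using lc[of n] pos[of n] pos[of "Suc n"] by (simp add: field_simps power2_eq_square)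
    with step.IH show ?case by simp
  qed simp
  have "a i * a (j + Suc d) = (a i * a (j + d)) * (a (Suc (j + d)) / a (j + d))"
    using pos[of "j + d"] by simp
  also have "\<dots> \<le> (a (i + d) * a j) * (a (Suc (i + d)) / a (i + d))"
    by (rule mult_mono) (use Suc step[of "i + d" "j + d"] ij in \<open>auto simp: less_imp_le[OF pos]\<close>)
  also have "\<dots> = a (i + Suc d) * a j"
    using pos[of "i + d"] by simp
  finally show ?case .
qed simp

text \<open>Sum the termwise exchange over \<open>i\<close> in the window from \<open>p\<close> to \<open>q\<close> and \<open>j\<close> in the window from \<open>r\<close> to \<open>s\<close>.
The thresholds may be negative; a window that begins below zero loses indices when its shift is pulled back, but
this is harmless: the left-hand side vanishes unless \<open>0 \<le> q\<close>, and then every index in the window from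
\<open>r + D\<close> to \<open>s + D\<close> is at least \<open>D\<close>.\<close>

lemma log_concave_sequence_window_exchange:
  fixes a :: "nat \<Rightarrow> real"
  assumes pos: "\<And>n. 0 < a n" and lc: "\<And>n. a n * a (n + 2) \<le> (a (n + 1))\<^sup>2"
    and le: "p \<le> q" "q \<le> r" "r \<le> s"
  defines "A \<equiv> \<lambda>c. \<Sum>n | real n \<le> c. a n"
  shows "(A q - A p) * (A (s + real D) - A (r + real D)) \<le> (A (q + real D) - A (p + real D)) * (A s - A r)"
proof -
  define W where "W u v = {n. u < real n \<and> real n \<le> v}" for u v
  have fin: "finite (W u v)" for u v
    unfolding W_def by (rule finite_subset[OF _ finite_nats_le[of v]]) auto
  have A: "A v - A u = sum a (W u v)" if "u \<le> v" for u v
  proof -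
    have "{n. real n \<le> v} = {n. real n \<le> u} \<union> W u v" using that by (auto simp: W_def)
    then have "A v = A u + sum a (W u v)"
      unfolding A_def by (simp only:) (rule sum.union_disjoint, auto simp: finite_nats_le fin, auto simp: W_def)
    then show ?thesis by simp
  qed
  have nn: "0 \<le> sum a S" for S using pos by (intro sum_nonneg) (simp add: less_imp_le)
  have "sum a (W p q) * sum a (W (r + D) (s + D)) \<le> sum a (W (p + D) (q + D)) * sum a (W r s)"
  proof (cases "W p q = {}")
    case False
    then have "0 \<le> r" using le by (auto simp: W_def)
    have "sum a (W p q) * sum a (W (r + D) (s + D)) \<le> sum a (W p q) * (\<Sum>j\<in>W r s. a (j + D))"
    proof (intro mult_left_mono nn)
      have "W (r + D) (s + D) \<subseteq> (\<lambda>j. j + D) ` W r s"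
      proof
        fix n assume n: "n \<in> W (r + D) (s + D)"
        then have "real D \<le> real n" using \<open>0 \<le> r\<close> by (simp add: W_def)
        then have "n = (n - D) + D" "n - D \<in> W r s" using n by (auto simp: W_def)
        then show "n \<in> (\<lambda>j. j + D) ` W r s" by blast
      qed
      then have "sum a (W (r + D) (s + D)) \<le> sum a ((\<lambda>j. j + D) ` W r s)"
        using pos by (intro sum_mono2) (auto simp: fin less_imp_le)
      also have "\<dots> = (\<Sum>j\<in>W r s. a (j + D))"
        by (subst sum.reindex) auto
      finally show "sum a (W (r + D) (s + D)) \<le> (\<Sum>j\<in>W r s. a (j + D))" .
    qed
    also have "\<dots> \<le> (\<Sum>i\<in>W p q. a (i + D)) * sum a (W r s)"
      unfolding sum_product
      using le by (intro sum_mono log_concave_sequence_exchange[OF pos lc]) (auto simp: W_def)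
    also have "\<dots> \<le> sum a (W (p + D) (q + D)) * sum a (W r s)"
    proof (intro mult_right_mono nn)
      have "(\<Sum>i\<in>W p q. a (i + D)) = sum a ((\<lambda>i. i + D) ` W p q)"
        by (subst sum.reindex) auto
      also have "\<dots> \<le> sum a (W (p + D) (q + D))"
        using pos by (intro sum_mono2) (auto simp: fin less_imp_le, auto simp: W_def)
      finally show "(\<Sum>i\<in>W p q. a (i + D)) \<le> sum a (W (p + D) (q + D))" .
    qed
    finally show ?thesis .
  qed (simp add: nn)
  then show ?thesis
    using le by (simp add: A)
qed

context half_line_measure
begin

text \<open>The extension of \<open>M\<close> by zero to the whole line, so that intervals may begin to the left of \<open>0\<close>: this is how a
possible atom at \<open>0\<close> enters the exchange inequality.\<close>

definition line_measure :: "real measure" where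
  "line_measure = distr M borel (\<lambda>x. x)"

lemma measurable_ident_M: "(\<lambda>x. x) \<in> M \<rightarrow>\<^sub>M borel"
  by (rule borel_measurable_M) simp

lemma sets_line_measure: "sets line_measure = sets borel"
  by (simp add: line_measure_def)

lemma emeasure_line_measure: "A \<in> sets borel \<Longrightarrow> emeasure line_measure A = emeasure M (A \<inter> {0..})"
  unfolding line_measure_def by (subst emeasure_distr[OF measurable_ident_M]) (auto simp: space_M)

lemma finite_borel_line_measure: "finite_borel_measure line_measure"
  by (auto intro!: finite_borel_measure.intro finite_measure_distr finite_borel_measure_axioms.intro
      simp: line_measure_def measurable_ident_M)

lemma integrable_poisson_weight:
  "0 < t \<Longrightarrow> integrable M (\<lambda>x. poisson_weight (t * x) n)"
  using integrable_mult_right[OF integrable_power_exp[of t n], of "t ^ n / fact n"]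
  by (simp add: poisson_weight_def power_mult_distrib mult_ac)

lemma integral_poisson_weight:
  "(\<integral>x. poisson_weight (t * x) n \<partial>M) = t ^ n / fact n * laplace_moment M n t"
  unfolding laplace_moment_def
  by (subst integral_mult_right_zero[symmetric]) (simp add: poisson_weight_def power_mult_distrib mult_ac)

text \<open>The sum is the integral of \<open>x \<mapsto> poisson_cdf (t x) (t z)\<close>, which converges boundedly to the indicator of
\<open>x \<le> z\<close> away from \<open>x = z\<close>.\<close>

lemma poisson_mixture_converges:
  fixes t :: "nat \<Rightarrow> real"
  assumes t: "filterlim t at_top sequentially" "\<And>k. 0 < t k" and z: "measure line_measure {z} = 0"
  shows "(\<lambda>k. \<Sum>n | real n \<le> t k * z. t k ^ n / fact n * laplace_moment M n (t k)) \<longlonglongrightarrow> cdf line_measure z"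
proof -
  have "(\<lambda>k. \<integral>x. poisson_cdf (t k * x) (t k * z) \<partial>M) \<longlonglongrightarrow> (\<integral>x. indicator {..z} x \<partial>M)"
  proof (rule integral_dominated_convergence)
    show "(\<lambda>x. indicator {..z} x :: real) \<in> borel_measurable M"
      by (rule borel_measurable_M) simp
    show "(\<lambda>x. poisson_cdf (t k * x) (t k * z)) \<in> borel_measurable M" for k
      unfolding poisson_cdf_def poisson_weight_def by (rule borel_measurable_M) simp
    show "integrable M (\<lambda>_. 1 :: real)" by simp
    show "AE x in M. norm (poisson_cdf (t k * x) (t k * z)) \<le> 1" for k
      using t(2)[of k] poisson_cdf_nonneg poisson_cdf_le_1 by (intro AE_I2) (auto simp: space_M)
    have "emeasure line_measure {z} = 0"
      using z finite_borel_line_measure by (simp add: finite_measure.emeasure_eq_measure finite_borel_measure.axioms(1))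
    then have "emeasure M ({z} \<inter> {0..}) = 0"
      by (simp add: emeasure_line_measure)
    then have "{z} \<inter> {0..} \<in> null_sets M"
      by (auto simp: null_sets_def sets_M_iff)
    then have "AE x in M. x \<notin> {z} \<inter> {0..}" by (rule AE_not_in)
    then show "AE x in M. (\<lambda>k. poisson_cdf (t k * x) (t k * z)) \<longlonglongrightarrow> indicator {..z} x"
      using AE_space
    proof eventually_elim
      case (elim x)
      then show ?case by (intro poisson_cdf_concentration t) (auto simp: space_M)
    qed
  qed
  moreover have "(\<integral>x. poisson_cdf (t k * x) (t k * z) \<partial>M) = (\<Sum>n | real n \<le> t k * z. t k ^ n / fact n * laplace_moment M n (t k))" for k
    unfolding poisson_cdf_def using t(2)[of k]
    by (subst Bochner_Integration.integral_sum) (auto simp: integral_poisson_weight integrable_poisson_weight)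
  moreover have "(\<integral>x. indicator {..z} x \<partial>M) = cdf line_measure z"
    by (simp add: cdf_def measure_def emeasure_line_measure space_M)
  ultimately show ?thesis by simp
qed

text \<open>Choosing \<open>t\<close> as a multiple of \<open>1/d\<close> makes the shift by \<open>d\<close> a shift by a whole number of indices, so the
windows of the Poisson mixtures match exactly.  The limit is available when none of the eight end points is an
atom; in general all of them are moved to the right by a common small amount that avoids the countably many
atoms, and right-continuity removes this amount again.\<close>

lemma cdf_exchange:
  assumes M: "emeasure M {0<..} \<noteq> 0"
    and ineq: "\<And>n t. 1 \<le> n \<Longrightarrow> 0 < t \<Longrightarrow>
      real n * laplace_moment M (n - 1) t * laplace_moment M (n + 1) t \<le> (real n + 1) * (laplace_moment M n t)\<^sup>2"
    and le: "x1 \<le> x2" "x2 \<le> y1" "y1 \<le> y2" "0 \<le> d"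
  defines "F \<equiv> cdf line_measure"
  shows "(F x2 - F x1) * (F (y2 + d) - F (y1 + d)) \<le> (F (x2 + d) - F (x1 + d)) * (F y2 - F y1)"
proof (cases "d = 0")
  case False
  with le have d: "0 < d" by simp
  interpret L: finite_borel_measure line_measure by (rule finite_borel_line_measure)
  have regular: "(F x2 - F x1) * (F (y2 + d) - F (y1 + d)) \<le> (F (x2 + d) - F (x1 + d)) * (F y2 - F y1)"
    if le: "x1 \<le> x2" "x2 \<le> y1" "y1 \<le> y2"
      and na: "\<And>z. z \<in> {x1, x2, y1, y2, x1 + d, x2 + d, y1 + d, y2 + d} \<Longrightarrow> measure line_measure {z} = 0"
    for x1 x2 y1 y2
  proof -
    \<comment> \<open>With this choice a shift by \<open>d\<close> becomes a shift by \<open>Suc k\<close> indices.\<close>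
    define t where "t k = real (Suc k) / d" for k
    have tpos: "0 < t k" for k using d by (simp add: t_def)
    have "filterlim (\<lambda>k. real (Suc k)) at_top sequentially"
      by (rule filterlim_compose[OF filterlim_real_sequentially filterlim_Suc])
    then have "filterlim (\<lambda>k. inverse d * real (Suc k)) at_top sequentially"
      using d by (intro filterlim_tendsto_pos_mult_at_top[OF tendsto_const]) auto
    then have t: "filterlim t at_top sequentially"
      by (simp add: t_def[abs_def] divide_inverse mult.commute)
    define A where "A k c = (\<Sum>n | real n \<le> c. t k ^ n / fact n * laplace_moment M n (t k))" for k c
    have lim: "(\<lambda>k. A k (t k * z)) \<longlonglongrightarrow> F z"
      if "z \<in> {x1, x2, y1, y2, x1 + d, x2 + d, y1 + d, y2 + d}" for z
      unfolding A_def F_def by (rule poisson_mixture_converges[OF t tpos na[OF that]])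
    have shift: "t k * (z + d) = t k * z + real (Suc k)" for k z
      using d by (simp add: t_def field_simps)
    have ex: "(A k (t k * x2) - A k (t k * x1)) * (A k (t k * (y2 + d)) - A k (t k * (y1 + d)))
        \<le> (A k (t k * (x2 + d)) - A k (t k * (x1 + d))) * (A k (t k * y2) - A k (t k * y1))" for k
      unfolding shift A_def
    proof (rule log_concave_sequence_window_exchange)
      show "0 < t k ^ n / fact n * laplace_moment M n (t k)" for n
        using tpos[of k] laplace_moment_pos[OF tpos M] by simp
      fix n
      define m where "m i = laplace_moment M i (t k)" for i
      \<comment> \<open>Up to a common factor this is log-concavity of the masses \<open>t\<^sup>n m\<^sub>n / n!\<close>.\<close>
      have "real (n + 1) * m n * m (n + 2) \<le> (real (n + 1) + 1) * (m (n + 1))\<^sup>2"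
        using ineq[of "n + 1" "t k"] tpos by (simp add: m_def)
      then have "(t k ^ (2 * n + 2) / (fact n * fact (n + 2) * real (n + 1))) * (real (n + 1) * m n * m (n + 2))
          \<le> (t k ^ (2 * n + 2) / (fact n * fact (n + 2) * real (n + 1))) * ((real (n + 1) + 1) * (m (n + 1))\<^sup>2)"
        using tpos[of k] by (intro mult_left_mono) auto
      moreover have "(t k ^ (2 * n + 2) / (fact n * fact (n + 2) * real (n + 1))) * (real (n + 1) * m n * m (n + 2))
         = t k ^ n / fact n * m n * (t k ^ (n + 2) / fact (n + 2) * m (n + 2))"
        by (simp add: power_add mult_2 del: fact_Suc of_nat_Suc)
      moreover have "(t k ^ (2 * n + 2) / (fact n * fact (n + 2) * real (n + 1))) * ((real (n + 1) + 1) * (m (n + 1))\<^sup>2)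
         = (t k ^ (n + 1) / fact (n + 1) * m (n + 1))\<^sup>2"
      proof -
        have cancel: "T * T / (c * ((p + 1) * (p * c)) * p) * ((p + 1) * w\<^sup>2) = (T / (p * c) * w)\<^sup>2"
          if "p \<noteq> 0" "p + 1 \<noteq> 0" for T c p w :: real
          using that by (simp add: power2_eq_square mult_ac)
        have "(fact (n + 2) :: real) = (real (n + 1) + 1) * (real (n + 1) * fact n)"
          "(fact (n + 1) :: real) = real (n + 1) * fact n"
          by (simp_all add: algebra_simps)
        moreover have "t k ^ (2 * n + 2) = t k ^ (n + 1) * t k ^ (n + 1)"
          unfolding power_add[symmetric] by (simp add: mult_2)
        ultimately show ?thesis
          by (simp only:) (rule cancel, auto)
      qed
      ultimately show "t k ^ n / fact n * laplace_moment M n (t k) * (t k ^ (n + 2) / fact (n + 2) * laplace_moment M (n + 2) (t k))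
        \<le> (t k ^ (n + 1) / fact (n + 1) * laplace_moment M (n + 1) (t k))\<^sup>2"
        by (simp only: m_def)
    qed (use le tpos[of k] in auto)
    have "(\<lambda>k. (A k (t k * x2) - A k (t k * x1)) * (A k (t k * (y2 + d)) - A k (t k * (y1 + d))))
        \<longlonglongrightarrow> (F x2 - F x1) * (F (y2 + d) - F (y1 + d))"
      "(\<lambda>k. (A k (t k * (x2 + d)) - A k (t k * (x1 + d))) * (A k (t k * y2) - A k (t k * y1)))
        \<longlonglongrightarrow> (F (x2 + d) - F (x1 + d)) * (F y2 - F y1)"
      by (intro tendsto_mult tendsto_diff lim; simp)+
    then show ?thesis
      using ex by (meson LIMSEQ_le)
  qed
  define P where "P = {x1, x2, y1, y2, x1 + d, x2 + d, y1 + d, y2 + d}"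
  \<comment> \<open>The set of forbidden shifts is countable, an interval is not.\<close>
  have "\<exists>e. 0 < e \<and> e < inverse (real (Suc k)) \<and> (\<forall>z\<in>P. measure line_measure {z + e} = 0)" for k
  proof -
    have "countable (\<Union>z\<in>P. (\<lambda>w. w - z) ` {w. measure line_measure {w} \<noteq> 0})"
      by (intro countable_UN countable_image L.countable_support) (auto simp: P_def)
    then have "\<not> {0<..<inverse (real (Suc k))} \<subseteq> (\<Union>z\<in>P. (\<lambda>w. w - z) ` {w. measure line_measure {w} \<noteq> 0})"
      using uncountable_open_interval[of 0 "inverse (real (Suc k))"] countable_subset by auto
    then obtain e where "e \<in> {0<..<inverse (real (Suc k))}"
      and e_notin: "e \<notin> (\<Union>z\<in>P. (\<lambda>w. w - z) ` {w. measure line_measure {w} \<noteq> 0})" by blast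
    then have e: "0 < e" "e < inverse (real (Suc k))" by auto
    have "measure line_measure {z + e} = 0" if "z \<in> P" for z
    proof (rule ccontr)
      assume "measure line_measure {z + e} \<noteq> 0"
      then have "e \<in> (\<lambda>w. w - z) ` {w. measure line_measure {w} \<noteq> 0}"
        by (intro image_eqI[of _ _ "z + e"]) auto
      with e_notin that show False by blast
    qed
    with e show ?thesis by blast
  qed
  then obtain e where e: "\<And>k. 0 < e k" "\<And>k. e k < inverse (real (Suc k))"
    "\<And>k z. z \<in> P \<Longrightarrow> measure line_measure {z + e k} = 0" by metis
  have e0: "e \<longlonglongrightarrow> 0"
    by (rule tendsto_sandwich[OF _ _ tendsto_const LIMSEQ_inverse_real_of_nat])
      (use e in \<open>auto intro!: always_eventually less_imp_le\<close>)
  have lim: "(\<lambda>k. F (z + e k)) \<longlonglongrightarrow> F z" for z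
  proof -
    have "(F \<longlongrightarrow> F z) (at_right z)"
      using L.cdf_is_right_cont[of z] by (simp add: continuous_within F_def)
    moreover have "filterlim (\<lambda>k. z + e k) (at_right z) sequentially"
    proof -
      have "z + e k \<in> {z<..} \<and> z + e k \<noteq> z" for k
        using e(1)[of k] by simp
      then show ?thesis
        using tendsto_add[OF tendsto_const[of z] e0] by (simp add: filterlim_at)
    qed
    ultimately show ?thesis by (rule filterlim_compose)
  qed
  have "(F (x2 + e k) - F (x1 + e k)) * (F (y2 + d + e k) - F (y1 + d + e k))
      \<le> (F (x2 + d + e k) - F (x1 + d + e k)) * (F (y2 + e k) - F (y1 + e k))" for k
  proof -
    have swap: "z + d + e k = z + e k + d" for z by simp
    have "measure line_measure {w} = 0"
      if w: "w \<in> {x1 + e k, x2 + e k, y1 + e k, y2 + e k, x1 + e k + d, x2 + e k + d, y1 + e k + d, y2 + e k + d}" for w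
    proof -
      have "w \<in> (\<lambda>z. z + e k) ` P"
        using w unfolding P_def image_insert swap image_empty .
      then show ?thesis using e(3) by blast
    qed
    then show ?thesis
      unfolding swap using le by (intro regular) simp_all
  qed
  moreover have "(\<lambda>k. (F (x2 + e k) - F (x1 + e k)) * (F (y2 + d + e k) - F (y1 + d + e k)))
      \<longlonglongrightarrow> (F x2 - F x1) * (F (y2 + d) - F (y1 + d))"
    "(\<lambda>k. (F (x2 + d + e k) - F (x1 + d + e k)) * (F (y2 + e k) - F (y1 + e k)))
      \<longlonglongrightarrow> (F (x2 + d) - F (x1 + d)) * (F y2 - F y1)"
    by (intro tendsto_mult tendsto_diff lim)+
  ultimately show ?thesis
    by (meson LIMSEQ_le)
qed simp

end

section \<open>Log-concavity from exchange and one-sided continuity\<close>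

text \<open>Along an arithmetic progression from \<open>x\<close> to \<open>y\<close> the exchange hypothesis makes the increments of \<open>ln g\<close>
decrease, which is log-concavity at rational weights.  A real weight is approached by rational ones from below,
and \<open>left\<close> transfers the bound to the limit point.\<close>

lemma exchange_imp_log_concave:
  fixes g :: "real \<Rightarrow> real"
  assumes nonneg: "\<And>x. 0 \<le> g x"
    and exchange: "\<And>x y d. x \<le> y \<Longrightarrow> 0 \<le> d \<Longrightarrow> g x * g (y + d) \<le> g (x + d) * g y"
    and left: "\<And>z (w :: nat \<Rightarrow> real). 0 < g z \<Longrightarrow> (\<And>k. w k \<le> z) \<Longrightarrow> w \<longlonglongrightarrow> z
        \<Longrightarrow> \<exists>c. c \<longlonglongrightarrow> 1 \<and> (\<forall>k. g (w k) \<le> c k * g z)"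
    and u: "0 < u" "u < 1"
  shows "g x powr u * g y powr (1 - u) \<le> g (u * x + (1 - u) * y)"
proof -
  have main: "g x powr (1 - s) * g y powr s \<le> g (x + s * (y - x))"
    if s: "0 < s" "s < 1" and xy: "x < y" and pos: "0 < g x" "0 < g y" for s x y
  proof -
    have between: "0 < g w" if "x \<le> w" "w \<le> y" for w
    proof -
      have "g x * g y \<le> g w * g (x + y - w)"
        using exchange[of x "x + y - w" "w - x"] that by simp
      then have "0 < g w * g (x + y - w)" using pos by (meson less_le_trans mult_pos_pos)
      then show ?thesis using nonneg[of w] by (metis mult_zero_left order_less_le)
    qed
    have rational: "g x powr (1 - real j / real q) * g y powr (real j / real q) \<le> g (x + real j / real q * (y - x))"
      if j: "j < q" for j q :: nat
    proof -
      define p where "p i = x + real i / real q * (y - x)" for i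
      define c where "c i = ln (g (p i))" for i
      define D where "D i = c (Suc i) - c i" for i
      have q: "0 < real q" using j by simp
      have p_in: "x \<le> p i" "p i \<le> y" if "i \<le> q" for i
      proof -
        show "x \<le> p i" using xy by (simp add: p_def)
        have "real i / real q * (y - x) \<le> 1 * (y - x)"
          using that xy q by (intro mult_right_mono) auto
        then show "p i \<le> y" by (simp add: p_def)
      qed
      have p_Suc: "p (Suc i) = p i + (y - x) / real q" for i
        by (simp add: p_def add_divide_distrib distrib_right)
      have p_mono: "p i \<le> p k" if "i \<le> k" for i k
        using that xy q by (simp add: p_def mult_right_mono divide_right_mono)
      have D: "D k \<le> D i" if "i \<le> k" "k < q" for i k
      proof -
        have gp: "0 < g (p l)" if "l \<le> q" for l using between p_in that by simp
        have "g (p i) * g (p (Suc k)) \<le> g (p (Suc i)) * g (p k)"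
          unfolding p_Suc using that xy by (intro exchange p_mono) auto
        then have "ln (g (p i) * g (p (Suc k))) \<le> ln (g (p (Suc i)) * g (p k))"
          using gp that by simp
        then show ?thesis
          using gp[of i] gp[of k] gp[of "Suc k"] gp[of "Suc i"] that by (simp add: D_def c_def ln_mult)
      qed
      have "real j * D j \<le> (\<Sum>i<j. D i)"
        using sum_mono[of "{..<j}" "\<lambda>_. D j" D] D j by simp
      also have "\<dots> = c j - c 0"
        unfolding D_def by (rule sum_lessThan_telescope)
      finally have 1: "real j * D j \<le> c j - c 0" .
      have "c q - c j = (\<Sum>i=j..<q. D i)"
        unfolding D_def using j by (simp add: sum_Suc_diff')
      also have "\<dots> \<le> real (q - j) * D j"
        using sum_mono[of "{j..<q}" D "\<lambda>_. D j"] D by simp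
      finally have 2: "c q - c j \<le> (real q - real j) * D j" using j by (simp add: of_nat_diff)
      have "real j * (c q - c j) \<le> real j * ((real q - real j) * D j)"
        using 2 by (intro mult_left_mono) auto
      also have "\<dots> = (real q - real j) * (real j * D j)" by simp
      also have "\<dots> \<le> (real q - real j) * (c j - c 0)"
        using 1 j by (intro mult_left_mono) auto
      finally have "(real q - real j) * c 0 + real j * c q \<le> real q * c j"
        by (simp add: algebra_simps)
      then have "(1 - real j / real q) * c 0 + real j / real q * c q \<le> c j"
        using q by (simp add: field_simps)
      moreover have "c 0 = ln (g x)" "c q = ln (g y)" using q by (simp_all add: c_def p_def)
      ultimately have "exp ((1 - real j / real q) * ln (g x) + real j / real q * ln (g y)) \<le> exp (ln (g (p j)))"
        by (simp add: c_def)
      then show ?thesis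
        using pos between[of "p j"] p_in[of j] j by (simp add: powr_def exp_add p_def)
    qed
    \<comment> \<open>The largest \<open>j\<close> with \<open>j / q < s\<close>: the fractions approach \<open>s\<close> strictly from below.\<close>
    define q j where "q k = Suc k" and "j k = nat (\<lceil>s * real (q k)\<rceil> - 1)" for k
    define r where "r k = real (j k) / real (q k)" for k
    have jq: "real (j k) < s * real (q k)" "s * real (q k) \<le> real (j k) + 1" for k
    proof -
      have "0 < s * real (q k)" using s by (simp add: q_def)
      then have "0 < \<lceil>s * real (q k)\<rceil>" by simp
      then have "real (j k) = real_of_int \<lceil>s * real (q k)\<rceil> - 1" unfolding j_def by simp
      then show "real (j k) < s * real (q k)" "s * real (q k) \<le> real (j k) + 1"
        using ceiling_correct[of "s * real (q k)"] by linarith+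
    qed
    have qpos: "0 < real (q k)" for k by (simp add: q_def)
    have j_less: "j k < q k" for k
    proof -
      have "s * real (q k) < 1 * real (q k)" using s qpos by (intro mult_strict_right_mono)
      with jq(1)[of k] have "real (j k) < real (q k)" by linarith
      then show ?thesis by simp
    qed
    have r: "r k < s" "s - inverse (real (Suc k)) \<le> r k" for k
    proof -
      have "s \<le> (real (j k) + 1) / real (q k)"
        using jq(2)[of k] qpos[of k] by (simp add: pos_le_divide_eq)
      then show "s - inverse (real (Suc k)) \<le> r k"
        unfolding r_def q_def[symmetric] by (simp add: add_divide_distrib inverse_eq_divide)
      show "r k < s"
        using jq(1)[of k] qpos[of k] by (simp add: r_def pos_divide_less_eq)
    qed
    have r_lim: "r \<longlonglongrightarrow> s"
    proof (rule tendsto_sandwich)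
      show "(\<lambda>k. s - inverse (real (Suc k))) \<longlonglongrightarrow> s"
        using tendsto_diff[OF tendsto_const[of s] LIMSEQ_inverse_real_of_nat] by simp
    qed (use r in \<open>auto intro!: always_eventually less_imp_le\<close>)
    define z where "z = x + s * (y - x)"
    have z: "0 < g z"
    proof (rule between)
      have "s * (y - x) \<le> 1 * (y - x)" using s xy by (intro mult_right_mono) auto
      then show "z \<le> y" by (simp add: z_def)
      show "x \<le> z" using s xy by (simp add: z_def)
    qed
    have "(\<lambda>k. x + r k * (y - x)) \<longlonglongrightarrow> z"
      unfolding z_def by (intro tendsto_intros r_lim)
    moreover have "x + r k * (y - x) \<le> z" for k
      using r(1)[of k] xy by (simp add: z_def mult_right_mono)
    ultimately obtain c where c: "c \<longlonglongrightarrow> 1" "\<And>k. g (x + r k * (y - x)) \<le> c k * g z"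
      using left[OF z, of "\<lambda>k. x + r k * (y - x)"] by blast
    have "g x powr (1 - r k) * g y powr (r k) \<le> c k * g z" for k
      using rational[OF j_less[of k]] c(2)[of k] unfolding r_def by linarith
    moreover have "(\<lambda>k. g x powr (1 - r k) * g y powr (r k)) \<longlonglongrightarrow> g x powr (1 - s) * g y powr s"
      using pos by (intro tendsto_intros r_lim) auto
    moreover have "(\<lambda>k. c k * g z) \<longlonglongrightarrow> 1 * g z"
      by (intro tendsto_intros c)
    ultimately have "g x powr (1 - s) * g y powr s \<le> 1 * g z"
      by (meson LIMSEQ_le)
    then show ?thesis by (simp add: z_def)
  qed
  consider "g x = 0 \<or> g y = 0" | "0 < g x" "0 < g y" "x < y" | "0 < g x" "0 < g y" "y < x" | "x = y"
    using nonneg[of x] nonneg[of y] by fastforce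
  then show ?thesis
  proof cases
    case 1
    then show ?thesis using nonneg by auto
  next
    case 2
    then show ?thesis using main[of "1 - u" x y] u by (simp add: algebra_simps)
  next
    case 3
    then show ?thesis using main[of u y x] u by (simp add: algebra_simps)
  next
    case 4
    have "g x powr u * g x powr (1 - u) = g x" using nonneg[of x] by (simp flip: powr_add)
    then show ?thesis using 4 by (simp add: algebra_simps)
  qed
qed

section \<open>The density of a measure with the exchange inequality\<close>

definition dyadic :: "nat \<Rightarrow> real" where
  "dyadic n = inverse (2 ^ n)"

lemma dyadic_pos [simp]: "0 < dyadic n"
  by (simp add: dyadic_def)

lemma dyadic_nonneg [simp]: "0 \<le> dyadic n"
  by (simp add: dyadic_def)

lemma dyadic_nonzero [simp]: "dyadic n \<noteq> 0"
  by (simp add: dyadic_def)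

lemma dyadic_antimono: "m \<le> n \<Longrightarrow> dyadic n \<le> dyadic m"
  unfolding dyadic_def by (intro le_imp_inverse_le power_increasing) auto

lemma dyadic_tendsto: "dyadic \<longlonglongrightarrow> 0"
  unfolding dyadic_def[abs_def] by (rule LIMSEQ_inverse_realpow_zero) simp

text \<open>The exchange inequality \<open>N I * N (J + d) \<le> N (I + d) * N J\<close> for the half-open intervals
\<open>I = {x1<..x2}\<close> and \<open>J = {y1<..y2}\<close>, where \<open>I\<close> lies to the left of \<open>J\<close>.\<close>

locale exchange_measure = finite_borel_measure N for N :: "real measure" +
  assumes exchange: "x1 \<le> x2 \<Longrightarrow> x2 \<le> y1 \<Longrightarrow> y1 \<le> y2 \<Longrightarrow> 0 \<le> d \<Longrightarrow>
    (cdf N x2 - cdf N x1) * (cdf N (y2 + d) - cdf N (y1 + d)) \<le> (cdf N (x2 + d) - cdf N (x1 + d)) * (cdf N y2 - cdf N y1)"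
begin

definition tail :: "real \<Rightarrow> real" where
  "tail x = measure N (space N) - cdf N x"

lemma tail_nonneg: "0 \<le> tail x"
  using cdf_bounded by (simp add: tail_def)

lemma tail_antimono: "x \<le> y \<Longrightarrow> tail y \<le> tail x"
  using cdf_nondecreasing by (simp add: tail_def)

lemma tail_at_top: "(tail \<longlongrightarrow> 0) at_top"
  using tendsto_diff[OF tendsto_const[of "measure N (space N)"] cdf_lim_at_top] by (simp add: tail_def[abs_def])

lemma tail_at_right: "(tail \<longlongrightarrow> tail x) (at_right x)"
  using cdf_is_right_cont[of x] unfolding tail_def[abs_def] continuous_within by (intro tendsto_intros)

lemma tail_right_seq:
  assumes "\<And>n. x < w n" "w \<longlonglongrightarrow> x"
  shows "(\<lambda>n. tail (w n)) \<longlonglongrightarrow> tail x"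
proof (rule filterlim_compose[OF tail_at_right])
  have "w n \<in> {x<..} \<and> w n \<noteq> x" for n
    using assms(1)[of n] by simp
  then show "filterlim w (at_right x) sequentially"
    using assms(2) by (simp add: filterlim_at)
qed

lemma emeasure_tail: "emeasure N {x<..} = ennreal (tail x)"
proof -
  have "measure N {x<..} = tail x"
  proof -
    have "{x<..} = space N - {..x}" by (auto simp: borel_UNIV)
    then show ?thesis
      using finite_measure_compl[of "{..x}"] by (simp add: tail_def cdf_def sets_M)
  qed
  then show ?thesis by (simp add: emeasure_eq_measure)
qed

lemma measurable_tail [measurable]: "tail \<in> borel_measurable borel"
proof -
  have "(\<lambda>x. - tail x) \<in> borel_measurable borel"
    by (rule borel_measurable_mono) (auto simp: mono_def tail_antimono)
  then show ?thesis by simp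
qed

text \<open>The exchange inequality for an unbounded second interval.\<close>

lemma tail_exchange:
  assumes "x1 \<le> x2" "x2 \<le> y" "0 \<le> d"
  shows "(tail x1 - tail x2) * tail (y + d) \<le> (tail (x1 + d) - tail (x2 + d)) * tail y"
proof -
  have le: "\<forall>\<^sub>F z in at_top. (tail x1 - tail x2) * (tail (y + d) - tail (z + d)) \<le> (tail (x1 + d) - tail (x2 + d)) * (tail y - tail z)"
    using eventually_ge_at_top[of y]
    by eventually_elim (use exchange[OF assms(1,2) _ assms(3)] in \<open>simp add: tail_def\<close>)
  have "((\<lambda>z. tail (z + d)) \<longlongrightarrow> 0) at_top"
    using tail_at_top
    by (rule filterlim_compose) (use filterlim_tendsto_add_at_top[OF tendsto_const[of d] filterlim_ident] in \<open>simp add: add.commute\<close>)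
  then have lhs: "((\<lambda>z. (tail x1 - tail x2) * (tail (y + d) - tail (z + d))) \<longlongrightarrow> (tail x1 - tail x2) * (tail (y + d) - 0)) at_top"
    by (intro tendsto_intros)
  have rhs: "((\<lambda>z. (tail (x1 + d) - tail (x2 + d)) * (tail y - tail z)) \<longlongrightarrow> (tail (x1 + d) - tail (x2 + d)) * (tail y - 0)) at_top"
    by (intro tendsto_intros tail_at_top)
  show ?thesis
    using tendsto_le[OF _ rhs lhs le] by simp
qed

text \<open>The unbounded interval may begin where the first one ends.\<close>

lemma tail_log_concave:
  assumes "x \<le> y" "0 \<le> d"
  shows "tail x * tail (y + d) \<le> tail (x + d) * tail y"
  using tail_exchange[OF assms(1) order_refl assms(2)] by (simp add: algebra_simps)

definition density_approx :: "nat \<Rightarrow> real \<Rightarrow> real" where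
  "density_approx n x = (tail x - tail (x + dyadic n)) / dyadic n"

text \<open>A difference quotient of the hazard rate \<open>- (ln tail)'\<close>, written with a ratio instead of a logarithm.  Unlike the
difference quotients of the tail itself it is monotone both in the step and in the position.\<close>

definition hazard_approx :: "nat \<Rightarrow> real \<Rightarrow> real" where
  "hazard_approx n x = (tail x / tail (x + dyadic n) - 1) / dyadic n"

lemma density_approx_eq:
  "0 < tail (x + dyadic n) \<Longrightarrow> density_approx n x = hazard_approx n x * tail (x + dyadic n)"
  by (simp add: density_approx_def hazard_approx_def left_diff_distrib)

lemma density_approx_nonneg: "0 \<le> density_approx n x"
  by (simp add: density_approx_def tail_antimono)

lemma hazard_approx_nonneg:
  assumes "0 < tail (x + dyadic n)"
  shows "0 \<le> hazard_approx n x"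
  using assms tail_antimono[of x "x + dyadic n"] unfolding hazard_approx_def
  by (intro divide_nonneg_nonneg) (simp_all add: pos_le_divide_eq)

text \<open>Let \<open>u\<close> be the ratio of tails over half a step.  The ratio over the full step is at least \<open>u\<^sup>2\<close> by log-concavity
of the tail, and \<open>u\<^sup>2 - 1 \<ge> 2 (u - 1)\<close>.\<close>

lemma hazard_approx_antimono_step:
  assumes pos: "0 < tail (x + dyadic n)"
  shows "hazard_approx (Suc n) x \<le> hazard_approx n x"
proof -
  define h where "h = dyadic (Suc n)"
  have h: "0 < h" "dyadic n = 2 * h" by (simp_all add: h_def dyadic_def)
  define u where "u = tail x / tail (x + h)"
  have pos2: "0 < tail (x + 2 * h)" and pos1: "0 < tail (x + h)"
    using pos h tail_antimono[of "x + h" "x + 2 * h"] by simp_all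
  have "tail x * tail (x + 2 * h) \<le> tail (x + h) * tail (x + h)"
    using tail_log_concave[of x "x + h" h] h by (simp add: algebra_simps)
  then have "u \<le> tail (x + h) / tail (x + 2 * h)"
    using pos1 pos2 by (simp add: u_def pos_divide_le_eq pos_le_divide_eq)
  moreover have "0 \<le> u" using pos1 tail_nonneg by (simp add: u_def)
  ultimately have "u * u \<le> u * (tail (x + h) / tail (x + 2 * h))"
    by (rule mult_left_mono)
  also have "\<dots> = tail x / tail (x + 2 * h)"
    using pos1 by (simp add: u_def)
  finally have "2 * (u - 1) \<le> tail x / tail (x + 2 * h) - 1"
    using zero_le_square[of "u - 1"] by (simp add: algebra_simps)
  then have "2 * (u - 1) / (2 * h) \<le> (tail x / tail (x + 2 * h) - 1) / (2 * h)"
    using h by (intro divide_right_mono) auto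
  then show ?thesis
    unfolding hazard_approx_def h_def[symmetric] h(2) u_def[symmetric] mult_divide_mult_cancel_left[OF zero_neq_numeral[symmetric]] by simp
qed

lemma hazard_approx_antimono:
  assumes "m \<le> n" "0 < tail (x + dyadic m)"
  shows "hazard_approx n x \<le> hazard_approx m x"
  using assms(1)
proof (induction n rule: dec_induct)
  case (step n)
  have "dyadic n \<le> dyadic m"
    using step by (intro dyadic_antimono)
  then have "0 < tail (x + dyadic n)"
    using assms(2) tail_antimono[of "x + dyadic n" "x + dyadic m"] by simp
  from hazard_approx_antimono_step[OF this] step.IH show ?case by simp
qed simp

lemma hazard_approx_mono:
  assumes "x \<le> y" "0 < tail (y + dyadic n)"
  shows "hazard_approx n x \<le> hazard_approx n y"
proof -
  have "0 < tail (x + dyadic n)"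
    using assms tail_antimono[of "x + dyadic n" "y + dyadic n"] by simp
  moreover have "tail x * tail (y + dyadic n) \<le> tail (x + dyadic n) * tail y"
    using assms(1) by (intro tail_log_concave) auto
  ultimately have "tail x / tail (x + dyadic n) \<le> tail y / tail (y + dyadic n)"
    using assms(2) by (simp add: pos_divide_le_eq pos_le_divide_eq mult.commute)
  then show ?thesis by (simp add: hazard_approx_def divide_right_mono)
qed

lemma tail_dyadic: "(\<lambda>n. tail (x + dyadic n)) \<longlonglongrightarrow> tail x"
proof (rule tail_right_seq)
  show "(\<lambda>n. x + dyadic n) \<longlonglongrightarrow> x"
    using tendsto_add[OF tendsto_const[of x] dyadic_tendsto] by simp
qed simp

lemma eventually_tail_dyadic_pos:
  assumes "0 < tail x"
  shows "\<exists>m. 0 < tail (x + dyadic m)"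
  using order_tendstoD(1)[OF tail_dyadic assms] by (auto simp: eventually_sequentially)

lemma tail_pos_dyadic_mono:
  assumes "m \<le> n" "0 < tail (x + dyadic m)"
  shows "0 < tail (x + dyadic n)"
proof -
  have "dyadic n \<le> dyadic m"
    using assms(1) by (rule dyadic_antimono)
  then show ?thesis
    using assms(2) tail_antimono[of "x + dyadic n" "x + dyadic m"] by simp
qed

text \<open>Where the tail is positive, the hazard quotients decrease and are bounded below, and the tail is right-continuous.\<close>

lemma density_approx_convergent: "convergent (\<lambda>n. density_approx n x)"
proof (cases "0 < tail x")
  case True
  then obtain m where m: "0 < tail (x + dyadic m)"
    using eventually_tail_dyadic_pos by blast
  then have pos: "0 < tail (x + dyadic (n + m))" for n
    by (rule tail_pos_dyadic_mono[of m, rotated]) simp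
  have "decseq (\<lambda>n. hazard_approx (n + m) x)"
    by (rule decseq_SucI) (use hazard_approx_antimono_step[OF pos] in simp)
  moreover have "bdd_below (range (\<lambda>n. hazard_approx (n + m) x))"
    by (rule bdd_belowI[of _ 0]) (use hazard_approx_nonneg[OF pos] in auto)
  ultimately have "(\<lambda>n. hazard_approx (n + m) x) \<longlonglongrightarrow> (INF n. hazard_approx (n + m) x)"
    by (intro LIMSEQ_decseq_INF)
  then have "(\<lambda>n. hazard_approx (n + m) x * tail (x + dyadic (n + m))) \<longlonglongrightarrow> (INF n. hazard_approx (n + m) x) * tail x"
    by (rule tendsto_mult[OF _ LIMSEQ_ignore_initial_segment[OF tail_dyadic]])
  then have "(\<lambda>n. density_approx (n + m) x) \<longlonglongrightarrow> (INF n. hazard_approx (n + m) x) * tail x"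
    by (simp add: density_approx_eq[OF pos])
  then show ?thesis
    by (intro convergentI) (rule LIMSEQ_offset)
next
  case False
  have "density_approx n x = 0" for n
    using False tail_nonneg[of x] tail_nonneg[of "x + dyadic n"] tail_antimono[of x "x + dyadic n"]
    by (simp add: density_approx_def)
  then show ?thesis by (simp add: convergent_const)
qed

definition tail_density :: "real \<Rightarrow> real" where
  "tail_density x = lim (\<lambda>n. density_approx n x)"

lemma density_approx_tendsto: "(\<lambda>n. density_approx n x) \<longlonglongrightarrow> tail_density x"
  unfolding tail_density_def using density_approx_convergent convergent_LIMSEQ_iff by blast

lemma tail_density_nonneg: "0 \<le> tail_density x"
  using density_approx_tendsto by (rule LIMSEQ_le_const) (auto intro: density_approx_nonneg)

lemma measurable_density_approx [measurable]: "density_approx n \<in> borel_measurable borel"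
  unfolding density_approx_def[abs_def] by measurable

lemma measurable_tail_density [measurable]: "tail_density \<in> borel_measurable borel"
  by (rule borel_measurable_LIMSEQ_real[OF density_approx_tendsto]) measurable

lemma tail_density_eq_0:
  assumes "tail x = 0"
  shows "tail_density x = 0"
proof -
  have "density_approx n x = 0" for n
    using assms tail_nonneg[of "x + dyadic n"] tail_antimono[of x "x + dyadic n"]
    by (simp add: density_approx_def)
  then show ?thesis using LIMSEQ_unique[OF density_approx_tendsto] by simp
qed

text \<open>The exchange inequality for two intervals of the same small length, divided by the square of the length.\<close>

lemma tail_density_exchange:
  assumes "x \<le> y" "0 \<le> d"
  shows "tail_density x * tail_density (y + d) \<le> tail_density (x + d) * tail_density y"
proof (cases "x = y")
  case False
  with assms have xy: "x < y" by simp
  have "\<forall>\<^sub>F n in sequentially. dyadic n < y - x"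
    using order_tendstoD(2)[OF dyadic_tendsto, of "y - x"] xy by simp
  then have "\<forall>\<^sub>F n in sequentially. density_approx n x * density_approx n (y + d) \<le> density_approx n (x + d) * density_approx n y"
  proof eventually_elim
    case (elim n)
    define h where "h = dyadic n"
    have "(cdf N (x + h) - cdf N x) * (cdf N (y + h + d) - cdf N (y + d)) \<le> (cdf N (x + h + d) - cdf N (x + d)) * (cdf N (y + h) - cdf N y)"
      using elim assms by (intro exchange) (auto simp: h_def)
    then have "(tail x - tail (x + h)) * (tail (y + d) - tail (y + h + d))
      \<le> (tail (x + d) - tail (x + h + d)) * (tail y - tail (y + h))"
      by (simp add: tail_def)
    moreover have "y + d + h = y + h + d" "x + d + h = x + h + d" by simp_all
    ultimately show ?case
      unfolding density_approx_def h_def[symmetric] times_divide_times_eq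
      by (simp only:) (rule divide_right_mono, auto)
  qed
  then show ?thesis
    by (rule tendsto_le[OF sequentially_bot, rotated 2]) (intro tendsto_mult density_approx_tendsto)+
qed (simp add: mult.commute)

text \<open>In terms of the quotient \<open>tail_density / tail\<close>, the hazard rate is nondecreasing.\<close>

lemma hazard_rate_mono:
  assumes "w \<le> z"
  shows "tail_density w * tail z \<le> tail_density z * tail w"
proof -
  have "density_approx n w * tail (z + dyadic n) \<le> density_approx n z * tail (w + dyadic n)" for n
  proof -
    have "w + (z - w) = z" "w + dyadic n + (z - w) = z + dyadic n" by simp_all
    then show ?thesis
      using tail_exchange[of w "w + dyadic n" "w + dyadic n" "z - w"] assms
      by (simp add: density_approx_def divide_right_mono add.commute)
  qed
  moreover have "(\<lambda>n. density_approx n w * tail (z + dyadic n)) \<longlonglongrightarrow> tail_density w * tail z"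
    "(\<lambda>n. density_approx n z * tail (w + dyadic n)) \<longlonglongrightarrow> tail_density z * tail w"
    by (intro tendsto_mult density_approx_tendsto tail_dyadic)+
  ultimately show ?thesis
    by (meson LIMSEQ_le)
qed

text \<open>By monotonicity in position and step, one hazard quotient at \<open>b\<close> dominates all finer ones to the left of \<open>b\<close>.\<close>

lemma density_approx_bounded:
  assumes "0 < tail b"
  shows "\<exists>m C. \<forall>n\<ge>m. \<forall>x\<le>b. density_approx n x \<le> C"
proof -
  obtain m where m: "0 < tail (b + dyadic m)"
    using eventually_tail_dyadic_pos[OF assms] by blast
  have "density_approx n x \<le> hazard_approx m b * measure N (space N)" if n: "m \<le> n" and x: "x \<le> b" for n x
  proof -
    have pos: "0 < tail (b + dyadic n)" by (rule tail_pos_dyadic_mono[OF n m])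
    then have posx: "0 < tail (x + dyadic n)"
      using tail_antimono[of "x + dyadic n" "b + dyadic n"] x by simp
    have "hazard_approx n x \<le> hazard_approx m b"
      using hazard_approx_mono[OF x pos] hazard_approx_antimono[OF n m] by simp
    moreover have "tail (x + dyadic n) \<le> measure N (space N)"
      using cdf_nonneg by (simp add: tail_def)
    ultimately show ?thesis
      unfolding density_approx_eq[OF posx]
      using hazard_approx_nonneg[OF posx] posx by (intro mult_mono) auto
  qed
  then show ?thesis by blast
qed

lemma
  assumes "0 < h"
  defines "I \<equiv> \<lambda>a b. \<integral>x. indicator {a<..b} x * tail x \<partial>lborel"
  shows integrable_tail_Ioc: "integrable lborel (\<lambda>x. indicator {a<..b} x * tail x)"
    and tail_le_average: "tail (a + h) \<le> I a (a + h) / h"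
    and average_le_tail: "I a (a + h) / h \<le> tail a"
proof -
  show int: "integrable lborel (\<lambda>x. indicator {a<..b} x * tail x)" for a b :: real
  proof (rule Bochner_Integration.integrable_bound)
    show "integrable lborel (\<lambda>x. tail a * indicator {a<..b} x)"
      by (cases "a \<le> b") (auto intro!: integrable_mult_right integrable_real_indicator)
    show "AE x in lborel. norm (indicator {a<..b} x * tail x) \<le> norm (tail a * indicator {a<..b} x)"
      using tail_nonneg tail_antimono by (intro AE_I2) (auto simp: indicator_def)
  qed measurable
  have const: "(\<integral>x. indicator {a<..a + h} x * c \<partial>lborel) = h * c" for c :: real
    using assms(1) by simp
  have int_const: "integrable lborel (\<lambda>x. indicator {a<..a + h} x * c)" for c :: real
    using assms(1) by (intro integrable_mult_left integrable_real_indicator) auto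
  have "h * tail (a + h) \<le> I a (a + h)"
    unfolding I_def const[symmetric] using tail_antimono
    by (intro integral_mono int int_const) (auto simp: indicator_def)
  then show "tail (a + h) \<le> I a (a + h) / h"
    using assms(1) by (simp add: pos_le_divide_eq mult.commute)
  have "I a (a + h) \<le> h * tail a"
    unfolding I_def const[symmetric] using tail_antimono
    by (intro integral_mono int int_const) (auto simp: indicator_def)
  then show "I a (a + h) / h \<le> tail a"
    using assms(1) by (simp add: pos_divide_le_eq mult.commute)
qed

text \<open>The integral of a difference quotient of the tail telescopes to the difference of two averages of the tail, over
short intervals to the right of \<open>a\<close> and of \<open>b\<close>; these converge by right-continuity.  On the other side the
uniform bound of the difference quotients permits dominated convergence.\<close>

lemma emeasure_tail_density_Ioc:
  assumes ab: "a \<le> b" and pos: "0 < tail b"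
  shows "emeasure (density lborel (\<lambda>x. ennreal (tail_density x))) {a<..b} = ennreal (tail a - tail b)"
proof -
  define I where "I u v = (\<integral>x. indicator {u<..v} x * tail x \<partial>lborel)" for u v
  obtain m C where C: "\<And>n x. m \<le> n \<Longrightarrow> x \<le> b \<Longrightarrow> density_approx n x \<le> C"
    using density_approx_bounded[OF pos] by blast
  have C_nonneg: "0 \<le> C" using C[of m b] density_approx_nonneg[of m b] by simp
  have average: "(\<lambda>n. I u (u + dyadic n) / dyadic n) \<longlonglongrightarrow> tail u" for u
    by (rule tendsto_sandwich[OF _ _ tail_dyadic tendsto_const])
      (auto simp: I_def tail_le_average average_le_tail intro!: always_eventually)
  have approx_integral: "(\<integral>x. indicator {a<..b} x * density_approx n x \<partial>lborel)
      = I a (a + dyadic n) / dyadic n - I b (b + dyadic n) / dyadic n" for n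
  proof -
    let ?h = "dyadic n"
    have int: "integrable lborel (\<lambda>x. indicator {u<..v} x * tail x)" for u v
      by (rule integrable_tail_Ioc[of 1]) simp
    have shift_eq: "indicator {a + ?h<..b + ?h} (?h + 1 * x) * tail (?h + 1 * x) = indicator {a<..b} x * tail (x + ?h)" for x
      by (simp add: indicator_def add.commute)
    have shift: "I (a + ?h) (b + ?h) = (\<integral>x. indicator {a<..b} x * tail (x + ?h) \<partial>lborel)"
      unfolding I_def by (subst lborel_integral_real_affine[where c = 1 and t = ?h]) (simp_all only: shift_eq, simp_all)
    have int': "integrable lborel (\<lambda>x. indicator {a<..b} x * tail (x + ?h))"
      using lborel_integrable_real_affine[OF int[of "a + ?h" "b + ?h"], of 1 ?h] unfolding shift_eq by simp
    have "(\<integral>x. indicator {a<..b} x * density_approx n x \<partial>lborel)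
        = (\<integral>x. (indicator {a<..b} x * tail x - indicator {a<..b} x * tail (x + ?h)) / ?h \<partial>lborel)"
      by (intro Bochner_Integration.integral_cong refl) (simp add: density_approx_def right_diff_distrib)
    also have "\<dots> = (I a b - I (a + ?h) (b + ?h)) / ?h"
      unfolding shift using int[of a b] int' by (simp add: I_def)
    also have "I a b - I (a + ?h) (b + ?h) = I a (a + ?h) - I b (b + ?h)"
    proof -
      have "indicator {a<..b} x * tail x - indicator {a + h<..b + h} x * tail x
        = indicator {a<..a + h} x * tail x - indicator {b<..b + h} x * tail x" if "0 < h" for x h :: real
        using ab that by (auto simp: indicator_def)
      from this[OF dyadic_pos] have "(\<integral>x. indicator {a<..b} x * tail x - indicator {a + ?h<..b + ?h} x * tail x \<partial>lborel)
        = (\<integral>x. indicator {a<..a + ?h} x * tail x - indicator {b<..b + ?h} x * tail x \<partial>lborel)" by simp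
      then show ?thesis
        unfolding I_def using int by simp
    qed
    finally show ?thesis by (simp add: diff_divide_distrib)
  qed
  have lim: "(\<lambda>n. \<integral>x. indicator {a<..b} x * density_approx (n + m) x \<partial>lborel) \<longlonglongrightarrow> (\<integral>x. indicator {a<..b} x * tail_density x \<partial>lborel)"
   and int: "integrable lborel (\<lambda>x. indicator {a<..b} x * tail_density x)"
  proof -
    have 1: "(\<lambda>x. indicator {a<..b} x * tail_density x) \<in> borel_measurable lborel" by measurable
    have 2: "(\<lambda>x. indicator {a<..b} x * density_approx (n + m) x) \<in> borel_measurable lborel" for n by measurable
    have 3: "integrable lborel (\<lambda>x. indicator {a<..b} x * C)"
      using ab by (intro integrable_mult_left integrable_real_indicator) auto
    have 4: "AE x in lborel. (\<lambda>n. indicator {a<..b} x * density_approx (n + m) x) \<longlonglongrightarrow> indicator {a<..b} x * tail_density x"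
      by (intro AE_I2 tendsto_mult tendsto_const LIMSEQ_ignore_initial_segment density_approx_tendsto)
    have 5: "AE x in lborel. norm (indicator {a<..b} x * density_approx (n + m) x) \<le> indicator {a<..b} x * C" for n
      using C[of "n + m"] density_approx_nonneg by (intro AE_I2) (auto simp: indicator_def)
    show "(\<lambda>n. \<integral>x. indicator {a<..b} x * density_approx (n + m) x \<partial>lborel) \<longlonglongrightarrow> (\<integral>x. indicator {a<..b} x * tail_density x \<partial>lborel)"
      by (rule integral_dominated_convergence[OF 1 2 3 4 5])
    show "integrable lborel (\<lambda>x. indicator {a<..b} x * tail_density x)"
      by (rule integrable_dominated_convergence[OF 1 2 3 4 5])
  qed
  have "(\<lambda>n. I a (a + dyadic (n + m)) / dyadic (n + m) - I b (b + dyadic (n + m)) / dyadic (n + m)) \<longlonglongrightarrow> tail a - tail b"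
    by (intro tendsto_diff LIMSEQ_ignore_initial_segment[OF average])
  with lim have eq: "(\<integral>x. indicator {a<..b} x * tail_density x \<partial>lborel) = tail a - tail b"
    unfolding approx_integral by (rule LIMSEQ_unique)
  have "emeasure (density lborel (\<lambda>x. ennreal (tail_density x))) {a<..b} = (\<integral>\<^sup>+x. ennreal (indicator {a<..b} x * tail_density x) \<partial>lborel)"
    by (subst emeasure_density) (auto intro!: nn_integral_cong simp: indicator_def)
  also have "\<dots> = ennreal (tail a - tail b)"
    unfolding eq[symmetric] by (intro nn_integral_eq_integral int) (simp add: tail_density_nonneg)
  finally show ?thesis .
qed

lemma tail_density_bounded:
  assumes "0 < tail b"
  shows "\<exists>C\<ge>0. \<forall>x\<le>b. tail_density x \<le> C"
proof -
  obtain m C where C: "\<And>n x. m \<le> n \<Longrightarrow> x \<le> b \<Longrightarrow> density_approx n x \<le> C"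
    using density_approx_bounded[OF assms] by blast
  have "tail_density x \<le> C" if "x \<le> b" for x
    using density_approx_tendsto by (rule LIMSEQ_le_const2) (use C that in auto)
  moreover have "0 \<le> C" using C[of m b] density_approx_nonneg[of m b] by simp
  ultimately show ?thesis by blast
qed

text \<open>To the left of a point with positive tail the density is bounded, hence the tail is Lipschitz there.\<close>

lemma tail_left_seq:
  assumes pos: "0 < tail z" and w: "\<And>k::nat. w k \<le> z" "w \<longlonglongrightarrow> z"
  shows "(\<lambda>k. tail (w k)) \<longlonglongrightarrow> tail z"
proof -
  obtain C where C: "0 \<le> C" "\<And>x. x \<le> z \<Longrightarrow> tail_density x \<le> C"
    using tail_density_bounded[OF pos] by blast
  have upper: "tail a \<le> tail z + C * (z - a)" if az: "a \<le> z" for a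
  proof -
    have "ennreal (tail a - tail z) = (\<integral>\<^sup>+x. ennreal (tail_density x) * indicator {a<..z} x \<partial>lborel)"
      unfolding emeasure_tail_density_Ioc[OF az pos, symmetric] by (subst emeasure_density) auto
    also have "\<dots> \<le> (\<integral>\<^sup>+x. ennreal C * indicator {a<..z} x \<partial>lborel)"
      using C by (intro nn_integral_mono) (auto simp: indicator_def ennreal_leI)
    also have "\<dots> = ennreal (C * (z - a))"
      using az C(1) by (simp add: nn_integral_cmult_indicator ennreal_mult)
    finally show ?thesis
      using az C(1) by (subst (asm) ennreal_le_iff) auto
  qed
  have "(\<lambda>k. tail z + C * (z - w k)) \<longlonglongrightarrow> tail z + C * (z - z)"
    by (intro tendsto_intros w)
  then have lim: "(\<lambda>k. tail z + C * (z - w k)) \<longlonglongrightarrow> tail z" by simp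
  show ?thesis
    by (rule tendsto_sandwich[OF _ _ tendsto_const lim])
      (use w(1) upper tail_antimono in \<open>auto intro!: always_eventually\<close>)
qed

text \<open>Monotonicity of the hazard rate bounds \<open>tail_density w\<close> by \<open>tail w / tail z * tail_density z\<close> for \<open>w \<le> z\<close>,
and the factor tends to \<open>1\<close> as \<open>w\<close> approaches \<open>z\<close>.\<close>

lemma tail_density_log_concave:
  assumes "0 < u" "u < 1"
  shows "tail_density x powr u * tail_density y powr (1 - u) \<le> tail_density (u * x + (1 - u) * y)"
proof (rule exchange_imp_log_concave[OF tail_density_nonneg tail_density_exchange _ assms])
  fix z and w :: "nat \<Rightarrow> real"
  assume z: "0 < tail_density z" and w: "\<And>k. w k \<le> z" "w \<longlonglongrightarrow> z"
  have pos: "0 < tail z"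
    using z tail_density_eq_0[of z] tail_nonneg[of z] by (cases "tail z = 0") auto
  have "(\<lambda>k. tail (w k)) \<longlonglongrightarrow> tail z"
    by (rule tail_left_seq[where w = w, OF pos w])
  then have "(\<lambda>k. tail (w k) / tail z) \<longlonglongrightarrow> tail z / tail z"
    using pos by (intro tendsto_intros) auto
  then have "(\<lambda>k. tail (w k) / tail z) \<longlonglongrightarrow> 1" using pos by simp
  moreover have "tail_density (w k) \<le> tail (w k) / tail z * tail_density z" for k
    using hazard_rate_mono[OF w(1)[of k]] pos by (simp add: pos_le_divide_eq mult.commute)
  ultimately show "\<exists>c. c \<longlonglongrightarrow> 1 \<and> (\<forall>k. tail_density (w k) \<le> c k * tail_density z)"
    by (intro exI[of _ "\<lambda>k. tail (w k) / tail z"]) auto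
qed

text \<open>Let \<open>I\<close> be the half-line up to a point \<open>x < b\<close> of positive mass, and let \<open>J = {b - 2 e<..b - e}\<close>.  Shifting
by \<open>e\<close> moves \<open>J\<close> onto \<open>{b - e<..b}\<close>, whose mass would stay away from zero if \<open>b\<close> were an atom, whereas the
mass of \<open>J\<close> tends to zero with \<open>e\<close>.\<close>

lemma no_atom_at_right_end:
  assumes mass: "\<exists>x<b. 0 < cdf N x" and b: "tail b = 0"
  shows "measure N {b} = 0"
proof -
  obtain x where x: "x < b" "0 < cdf N x" using mass by blast
  define F where "F = cdf N"
  have lower: "F x * (F b - F (b - e)) \<le> measure N (space N) * (F (b - e) - F (b - 2 * e))"
    if e: "0 < e" "2 * e \<le> b - x" for e
  proof -
    have ev: "\<forall>\<^sub>F z in at_bot. (F x - F z) * (F b - F (b - e)) \<le> measure N (space N) * (F (b - e) - F (b - 2 * e))"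
      using eventually_le_at_bot[of x]
    proof eventually_elim
      case (elim z)
      have "(F x - F z) * (F (b - e + e) - F (b - 2 * e + e)) \<le> (F (x + e) - F (z + e)) * (F (b - e) - F (b - 2 * e))"
        unfolding F_def using elim e by (intro exchange) auto
      also have "\<dots> \<le> measure N (space N) * (F (b - e) - F (b - 2 * e))"
      proof (intro mult_right_mono)
        show "F (x + e) - F (z + e) \<le> measure N (space N)"
          using cdf_bounded[of "x + e"] cdf_nonneg[of "z + e"] by (simp add: F_def)
        show "0 \<le> F (b - e) - F (b - 2 * e)" using e by (simp add: F_def cdf_nondecreasing)
      qed
      moreover have "b - 2 * e + e = b - e" "b - e + e = b" by simp_all
      ultimately show ?case by simp
    qed
    have "((\<lambda>z. (F x - F z) * (F b - F (b - e))) \<longlongrightarrow> (F x - 0) * (F b - F (b - e))) at_bot"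
      unfolding F_def by (intro tendsto_intros cdf_lim_at_bot)
    then have "(F x - 0) * (F b - F (b - e)) \<le> measure N (space N) * (F (b - e) - F (b - 2 * e))"
      by (rule tendsto_le[OF trivial_limit_at_bot_linorder tendsto_const _ ev])
    then show ?thesis by simp
  qed
  have "0 < (b - x) / 2" using x by simp
  from order_tendstoD(2)[OF dyadic_tendsto this]
  have ev: "\<forall>\<^sub>F n in sequentially. F x * (F b - F (b - dyadic n)) \<le> measure N (space N) * (F (b - dyadic n) - F (b - 2 * dyadic n))"
    by eventually_elim (rule lower, auto)
  have left: "(\<lambda>n. F (b - c * dyadic n)) \<longlonglongrightarrow> measure N {..<b}" if "0 < c" for c
    unfolding F_def
  proof (rule filterlim_compose[OF cdf_at_left])
    have "(\<lambda>n. b - c * dyadic n) \<longlonglongrightarrow> b - c * 0"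
      by (intro tendsto_intros dyadic_tendsto)
    moreover have "b - c * dyadic n \<in> {..<b} \<and> b - c * dyadic n \<noteq> b" for n
      using that by simp
    ultimately show "filterlim (\<lambda>n. b - c * dyadic n) (at_left b) sequentially"
      by (simp add: filterlim_at)
  qed
  have left1: "(\<lambda>n. F (b - dyadic n)) \<longlonglongrightarrow> measure N {..<b}" and left2: "(\<lambda>n. F (b - 2 * dyadic n)) \<longlonglongrightarrow> measure N {..<b}"
    using left[of 1] left[of 2] by simp_all
  have lhs: "(\<lambda>n. F x * (F b - F (b - dyadic n))) \<longlonglongrightarrow> F x * (F b - measure N {..<b})"
    by (intro tendsto_intros left1)
  have rhs: "(\<lambda>n. measure N (space N) * (F (b - dyadic n) - F (b - 2 * dyadic n)))
      \<longlonglongrightarrow> measure N (space N) * (measure N {..<b} - measure N {..<b})"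
    by (intro tendsto_intros left1 left2)
  have "F x * (F b - measure N {..<b}) \<le> measure N (space N) * (measure N {..<b} - measure N {..<b})"
    by (rule tendsto_le[OF sequentially_bot rhs lhs ev])
  then have "F b - measure N {..<b} \<le> 0"
    using x by (simp add: F_def mult_le_0_iff)
  moreover have "F b = measure N {..<b} + measure N {b}"
  proof -
    have "{..b} = {..<b} \<union> {b}" by auto
    then show ?thesis
      unfolding F_def cdf_def by (simp only:) (rule finite_measure_Union, auto simp: sets_M)
  qed
  ultimately show ?thesis
    using measure_nonneg[of N "{b}"] by linarith
qed

end

section \<open>Log-concave measures and their moments\<close>

context exchange_measure
begin

text \<open>The points approach the right end of the support, at which the tail vanishes in the limit precisely because there is
no atom.\<close>

lemma exhausting_sequence:
  assumes x: "0 < tail x" and no_atom: "\<forall>b. tail b = 0 \<longrightarrow> measure N {b} = 0"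
  shows "\<exists>z :: nat \<Rightarrow> real. incseq z \<and> (\<forall>n. x \<le> z n) \<and> (\<forall>n. 0 < tail (z n)) \<and>
    (\<lambda>n. tail (z n)) \<longlonglongrightarrow> 0 \<and> (\<forall>y. 0 < tail y \<longrightarrow> (\<exists>n. y \<le> z n))"
proof (cases "\<forall>y. 0 < tail y")
  case True
  show ?thesis
  proof (intro exI[of _ "\<lambda>n. x + real n"] conjI allI impI)
    show "incseq (\<lambda>n. x + real n)" by (simp add: incseq_def)
    show "(\<lambda>n. tail (x + real n)) \<longlonglongrightarrow> 0"
      using tail_at_top
      by (rule filterlim_compose) (rule filterlim_tendsto_add_at_top[OF tendsto_const filterlim_real_sequentially])
    show "\<exists>n. y \<le> x + real n" for y
      using real_arch_simple[of "y - x"] by (auto simp: algebra_simps)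
  qed (use True in auto)
next
  case False
  define Z where "Z = {y. tail y = 0}"
  define b where "b = Inf Z"
  have Z: "Z \<noteq> {}" using False tail_nonneg by (auto simp: Z_def less_le)
  have Z_lower: "x \<le> y" if "y \<in> Z" for y
    using that x tail_antimono[of y x] by (cases "x \<le> y") (auto simp: Z_def)
  have below: "0 < tail y" if "y < b" for y
    using that cInf_lower[of y Z] Z_lower tail_nonneg[of y] unfolding b_def[symmetric]
    by (force simp: Z_def bdd_below_def less_le)
  have tail_b: "tail b = 0"
  proof (rule ccontr)
    assume "tail b \<noteq> 0"
    then have "0 < tail b" using tail_nonneg[of b] by simp
    then obtain m where m: "0 < tail (b + dyadic m)" using eventually_tail_dyadic_pos by blast
    obtain y where "y \<in> Z" "y < b + dyadic m"
      using cInf_lessD[OF Z, of "b + dyadic m"] by (auto simp: b_def)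
    then show False using m tail_antimono[of y "b + dyadic m"] by (simp add: Z_def)
  qed
  have xb: "x < b" using x tail_b tail_antimono[of b x] by (cases "x < b") auto
  have atom: "measure N {b} = 0" using no_atom tail_b by blast
  \<comment> \<open>Begins at \<open>x\<close>, since \<open>dyadic 0 = 1\<close>, and increases to \<open>b\<close>.\<close>
  define z where "z n = b - (b - x) * dyadic n" for n
  have z_less: "z n < b" for n using xb by (simp add: z_def)
  have z_lim: "z \<longlonglongrightarrow> b"
  proof -
    have "z \<longlonglongrightarrow> b - (b - x) * 0"
      unfolding z_def[abs_def] by (intro tendsto_intros dyadic_tendsto)
    then show ?thesis by simp
  qed
  show ?thesis
  proof (intro exI[of _ z] conjI allI impI)
    show "incseq z"
      unfolding incseq_def z_def using xb by (auto intro!: mult_left_mono dyadic_antimono)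
    show "x \<le> z n" for n
    proof -
      have "(b - x) * dyadic n \<le> (b - x) * dyadic 0" using xb by (intro mult_left_mono dyadic_antimono) auto
      then show ?thesis by (simp add: z_def dyadic_def)
    qed
    show "0 < tail (z n)" for n by (rule below[OF z_less])
    have "isCont (cdf N) b" using atom by (simp add: isCont_cdf)
    then have "(\<lambda>n. cdf N (z n)) \<longlonglongrightarrow> cdf N b"
      using z_lim by (rule isCont_tendsto_compose)
    then have "(\<lambda>n. tail (z n)) \<longlonglongrightarrow> tail b"
      unfolding tail_def by (intro tendsto_intros)
    then show "(\<lambda>n. tail (z n)) \<longlonglongrightarrow> 0" by (simp add: tail_b)
    show "\<exists>n. y \<le> z n" if "0 < tail y" for y
    proof -
      have "y < b" using that tail_b tail_antimono[of b y] by (cases "y < b") auto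
      from order_tendstoD(1)[OF z_lim this] obtain n where "y < z n"
        by (auto simp: eventually_sequentially)
      then show ?thesis by (auto intro: less_imp_le)
    qed
  qed
qed

text \<open>Both measures agree on the intervals on which the tail is positive; these exhaust the support of the density.\<close>

lemma measure_eq_tail_density:
  assumes no_atom: "\<forall>b. tail b = 0 \<longrightarrow> measure N {b} = 0"
  shows "N = density lborel (\<lambda>x. ennreal (tail_density x))" (is "N = ?D")
proof (rule measure_eqI_lessThan)
  show "sets N = sets borel" by (rule M_is_borel)
  show "sets ?D = sets borel" by simp
  show "emeasure N {x<..} < \<infinity>" for x
    by (simp add: emeasure_tail)
  show "emeasure N {x<..} = emeasure ?D {x<..}" for x
  proof (cases "tail x = 0")
    case True
    then have "tail_density y = 0" if "x < y" for y
      using tail_density_eq_0[of y] tail_nonneg[of y] tail_antimono[of x y] that by simp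
    then have "ennreal (tail_density y) * indicator {x<..} y = 0" for y
      by (cases "x < y") auto
    then have "(\<integral>\<^sup>+y. ennreal (tail_density y) * indicator {x<..} y \<partial>lborel) = (\<integral>\<^sup>+y. 0 \<partial>(lborel :: real measure))"
      by (intro nn_integral_cong) simp
    then have "emeasure ?D {x<..} = 0"
      by (subst emeasure_density) simp_all
    then show ?thesis using True by (simp add: emeasure_tail)
  next
    case False
    then have pos: "0 < tail x" using tail_nonneg[of x] by simp
    obtain z :: "nat \<Rightarrow> real" where z: "incseq z" "\<And>n. x \<le> z n" "\<And>n. 0 < tail (z n)" "(\<lambda>n. tail (z n)) \<longlonglongrightarrow> 0"
      "\<And>y. 0 < tail y \<Longrightarrow> \<exists>n. y \<le> z n"
      using exhausting_sequence[OF pos no_atom] by blast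
    have "{x<..z m} \<subseteq> {x<..z n}" if "m \<le> n" for m n
      using incseqD[OF z(1) that] by auto
    then have lim: "(\<lambda>n. emeasure ?D {x<..z n}) \<longlonglongrightarrow> emeasure ?D (\<Union>n. {x<..z n})"
      by (intro Lim_emeasure_incseq) (auto simp: incseq_def)
    have union: "emeasure ?D (\<Union>n. {x<..z n}) = emeasure ?D {x<..}"
    proof -
      have "ennreal (tail_density y) * indicator (\<Union>n. {x<..z n}) y = ennreal (tail_density y) * indicator {x<..} y" for y
      proof (cases "tail y = 0")
        case False
        then have "\<exists>n. y \<le> z n" using z(5) tail_nonneg[of y] by (simp add: less_le)
        then show ?thesis by (auto simp: indicator_def)
      qed (simp add: tail_density_eq_0)
      then show ?thesis
        by (simp add: emeasure_density)
    qed
    have interval: "emeasure ?D {x<..z n} = ennreal (tail x - tail (z n))" for n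
      by (rule emeasure_tail_density_Ioc[OF z(2,3)])
    have "(\<lambda>n. ennreal (tail x - tail (z n))) \<longlonglongrightarrow> ennreal (tail x - 0)"
      by (intro tendsto_ennrealI tendsto_intros z)
    with lim have "emeasure ?D {x<..} = ennreal (tail x - 0)"
      unfolding interval union by (rule LIMSEQ_unique)
    then show ?thesis by (simp add: emeasure_tail)
  qed
qed

end

context half_line_measure
begin

lemma single_atom_log_concave:
  assumes b: "0 \<le> b" and null: "emeasure M ({0..} - {b}) = 0"
  shows "log_concave_measure M"
proof -
  have "M = scale_measure (ennreal (measure M {b})) (return borel_half_line b)"
  proof (rule measure_eqI)
    show "sets M = sets (scale_measure (ennreal (measure M {b})) (return borel_half_line b))"
      by (simp add: sets_M)
    fix A assume A: "A \<in> sets M"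
    then have A': "A \<in> sets borel" "A \<subseteq> {0..}" by (auto simp: sets_M_iff)
    have "emeasure M (A - {b}) \<le> emeasure M ({0..} - {b})"
      using A' by (intro emeasure_mono) (auto simp: sets_M_iff)
    then have zero: "emeasure M (A - {b}) = 0" using null by simp
    have "emeasure M A = emeasure M ((A - {b}) \<union> (A \<inter> {b}))"
      by (rule arg_cong[of _ _ "emeasure M"]) auto
    also have "\<dots> = emeasure M (A - {b}) + emeasure M (A \<inter> {b})"
      using A' b by (intro plus_emeasure[symmetric]) (auto simp: sets_M_iff)
    also have "\<dots> = emeasure M {b} * indicator A b"
      using zero by (auto simp: indicator_def)
    finally show "emeasure M A = emeasure (scale_measure (ennreal (measure M {b})) (return borel_half_line b)) A"
      using A by (simp add: emeasure_eq_measure emeasure_return flip: sets_M)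
  qed
  then show ?thesis
    unfolding log_concave_measure_def using b measure_nonneg by blast
qed

text \<open>If the right end of the support is an atom, then it is the only one and carries all the mass.  Otherwise the
density constructed from the tail is defined everywhere and log-concave.\<close>

lemma moment_inequality_imp_log_concave:
  assumes M: "emeasure M {0<..} \<noteq> 0"
    and ineq: "\<And>n t. 1 \<le> n \<Longrightarrow> 0 < t \<Longrightarrow>
      real n * laplace_moment M (n - 1) t * laplace_moment M (n + 1) t \<le> (real n + 1) * (laplace_moment M n t)\<^sup>2"
  shows "log_concave_measure M"
proof -
  interpret L: finite_borel_measure line_measure by (rule finite_borel_line_measure)
  interpret E: exchange_measure line_measure
    by unfold_locales (rule cdf_exchange[OF M ineq])
  show ?thesis
  proof (cases "\<exists>b. E.tail b = 0 \<and> measure line_measure {b} \<noteq> 0")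
    case True
    then obtain b where b: "E.tail b = 0" "measure line_measure {b} \<noteq> 0" by blast
    have "0 \<le> b"
    proof (rule ccontr)
      assume "\<not> 0 \<le> b"
      then have "{b} \<inter> {0..} = {}" by auto
      then show False using b(2) by (simp add: measure_def emeasure_line_measure)
    qed
    moreover have "emeasure M ({0..} - {b}) = 0"
    proof -
      have "cdf line_measure x = 0" if "x < b" for x
        using E.no_atom_at_right_end[OF _ b(1)] b(2) that L.cdf_nonneg[of x] by (auto simp: less_le)
      then have "(cdf line_measure \<longlongrightarrow> 0) (at_left b)"
        by (intro tendsto_eventually) (simp add: eventually_at_filter)
      then have "measure line_measure {..<b} = 0"
        using tendsto_unique[OF _ L.cdf_at_left[of b], of 0] by simp
      then have "emeasure line_measure {..<b} = 0" by (simp add: L.emeasure_eq_measure)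
      moreover have "emeasure line_measure {b<..} = 0" by (simp add: E.emeasure_tail b(1))
      ultimately have "emeasure line_measure ({..<b} \<union> {b<..}) = 0"
        by (subst emeasure_Un_null_set) (auto simp: null_sets_def sets_line_measure)
      moreover have "({..<b} \<union> {b<..}) \<inter> {0..} = {0..} - {b}" by auto
      ultimately show ?thesis by (simp add: emeasure_line_measure)
    qed
    ultimately show ?thesis by (rule single_atom_log_concave)
  next
    case False
    define f where "f = E.tail_density"
    have N: "line_measure = density lborel (\<lambda>x. ennreal (f x))"
      unfolding f_def using False by (intro E.measure_eq_tail_density) blast
    have f_borel [measurable]: "f \<in> borel_measurable borel"
      unfolding f_def by (rule E.measurable_tail_density)
    have meas: "f \<in> borel_measurable borel_half_line"
      by (rule measurable_restrict_space1) (rule f_borel)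
    have "M = density (restrict_space lborel {0..}) (\<lambda>x. ennreal (f x))"
    proof (rule measure_eqI)
      show sets: "sets M = sets (density (restrict_space lborel {0..}) (\<lambda>x. ennreal (f x)))"
        by (simp add: sets_M sets_restrict_space)
      fix A assume A: "A \<in> sets M"
      then have A': "A \<in> sets borel" "A \<subseteq> {0..}" by (auto simp: sets_M_iff)
      have "emeasure M A = emeasure line_measure A"
        using A' by (simp add: emeasure_line_measure Int_absorb2)
      also have "\<dots> = (\<integral>\<^sup>+x. ennreal (f x) * indicator A x \<partial>lborel)"
        unfolding N using A' by (subst emeasure_density) auto
      also have "\<dots> = (\<integral>\<^sup>+x. ennreal (f x) * indicator A x * indicator {0..} x \<partial>lborel)"
        using A' by (intro nn_integral_cong) (auto simp: indicator_def)
      also have "\<dots> = (\<integral>\<^sup>+x. ennreal (f x) * indicator A x \<partial>restrict_space lborel {0..})"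
        by (subst nn_integral_restrict_space) auto
      also have "\<dots> = emeasure (density (restrict_space lborel {0..}) (\<lambda>x. ennreal (f x))) A"
        using A sets by (subst emeasure_density) (auto intro!: measurable_restrict_space1)
      finally show "emeasure M A = emeasure (density (restrict_space lborel {0..}) (\<lambda>x. ennreal (f x))) A" .
    qed
    moreover have "log_concave_fun f"
      unfolding log_concave_fun_def f_def using E.tail_density_nonneg E.tail_density_log_concave by blast
    ultimately show ?thesis
      unfolding log_concave_measure_def using meas by blast
  qed
qed

text \<open>For a point mass the moments form a geometric sequence, so that even \<open>M\<^bsub>n-1\<^esub> M\<^bsub>n+1\<^esub> = M\<^sub>n\<^sup>2\<close>.\<close>

lemma log_concave_imp_moment_inequality:
  assumes lc: "log_concave_measure M" and n: "1 \<le> n" and t: "0 < t"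
  shows "real n * laplace_moment M (n - 1) t * laplace_moment M (n + 1) t \<le> (real n + 1) * (laplace_moment M n t)\<^sup>2"
  using lc unfolding log_concave_measure_def
proof (elim disjE exE conjE)
  fix c x0 :: real assume c: "0 \<le> c" and x0: "0 \<le> x0" and M: "M = scale_measure (ennreal c) (return borel_half_line x0)"
  have moment: "laplace_moment M k t = c * (x0 ^ k * exp (- t * x0))" for k
  proof -
    have meas: "(\<lambda>x. x ^ k * exp (- t * x)) \<in> borel_measurable borel_half_line"
      by (rule measurable_restrict_space1) measurable
    have "ennreal (laplace_moment M k t) = (\<integral>\<^sup>+x. ennreal (x ^ k * exp (- t * x)) \<partial>M)"
      unfolding laplace_moment_def
      by (intro nn_integral_eq_integral[symmetric] integrable_power_exp t) (auto simp: space_M)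
    also have "\<dots> = ennreal c * (\<integral>\<^sup>+x. ennreal (x ^ k * exp (- t * x)) \<partial>return borel_half_line x0)"
      unfolding M using meas by (intro nn_integral_scale_measure) simp
    also have "\<dots> = ennreal c * ennreal (x0 ^ k * exp (- t * x0))"
      using meas x0 by (subst nn_integral_return) (auto simp: space_restrict_space)
    also have "\<dots> = ennreal (c * (x0 ^ k * exp (- t * x0)))"
      using c x0 by (simp add: ennreal_mult)
    finally show ?thesis
      using c x0 by (subst (asm) ennreal_inj) (auto simp: laplace_moment_nonneg)
  qed
  have "x0 ^ (n - 1) * x0 ^ (n + 1) = x0 ^ n * x0 ^ n"
    using n by (cases n) (simp_all add: mult_ac)
  then have "laplace_moment M (n - 1) t * laplace_moment M (n + 1) t = (laplace_moment M n t)\<^sup>2"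
    unfolding moment power2_eq_square by (simp add: mult_ac)
  then have "real n * laplace_moment M (n - 1) t * laplace_moment M (n + 1) t = real n * (laplace_moment M n t)\<^sup>2"
    by (simp add: mult.assoc)
  also have "\<dots> \<le> (real n + 1) * (laplace_moment M n t)\<^sup>2"
    by (intro mult_right_mono) auto
  finally show ?thesis .
next
  fix f assume "f \<in> borel_measurable borel_half_line" "log_concave_fun f"
    "M = density (restrict_space lborel {0..}) (\<lambda>x. ennreal (f x))"
  then show ?thesis by (intro log_concave_density_imp_moment_inequality t n)
qed

text \<open>Without mass on the positive half-line all moments are independent of \<open>t\<close>, and a constant is convex, be it
finite or infinite.\<close>

lemma neg_root_convex_of_atom_at_zero:
  assumes null: "emeasure M {0<..} = 0"
  shows "ereal_convex_on {0<..} (\<lambda>t. neg_root n \<bar>(deriv ^^ k) (laplace_transform M) t\<bar>)"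
proof -
  have "{0::real<..} \<in> null_sets M" using null by (auto simp: null_sets_def sets_M_iff)
  then have "AE x in M. x \<notin> {0<..}" by (rule AE_not_in)
  then have AE0: "AE x in M. x = 0"
    using AE_space by eventually_elim (auto simp: space_M)
  define K where "K = neg_root n \<bar>laplace_moment M k 1\<bar>"
  have moment: "laplace_moment M k t = laplace_moment M k 1" for t
    unfolding laplace_moment_def
    by (rule integral_cong_AE) (use AE0 in \<open>auto intro!: borel_measurable_M\<close>)
  have "neg_root n \<bar>(deriv ^^ k) (laplace_transform M) t\<bar> = K" if "0 < t" for t
    using moment[of t] by (simp add: higher_deriv_laplace_transform[OF that] abs_mult power_abs K_def)
  then have "ereal_convex_on {0<..} (\<lambda>t. neg_root n \<bar>(deriv ^^ k) (laplace_transform M) t\<bar>)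
      \<longleftrightarrow> ereal_convex_on {0<..} (\<lambda>_. K)"
    by (intro ereal_convex_on_cong) auto
  moreover have "ereal_convex_on {0<..} (\<lambda>_. K)"
  proof (cases "K = \<infinity>")
    case True
    then show ?thesis using ereal_convex_on_top[of "{0::real<..}"] by simp
  next
    case False
    then have "laplace_moment M k 1 \<noteq> 0" by (auto simp: K_def neg_root_def)
    then show ?thesis by (simp add: K_def neg_root_def ereal_convex_on_ereal_iff convex_on_const)
  qed
  ultimately show ?thesis by simp
qed

end

theorem corollary1p2:
  fixes M :: "real measure"
  assumes "finite_measure M"
    and "sets M = sets borel_half_line"
  shows "log_concave_measure M \<longleftrightarrow>
    (\<forall>n::nat. n \<ge> 1 \<longrightarrow>
       ereal_convex_on {0<..}
         (\<lambda>t. neg_root n \<bar>(deriv ^^ (n - 1)) (laplace_transform M) t\<bar>))"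
proof -
  interpret half_line_measure M
    using assms by (intro half_line_measure.intro half_line_measure_axioms.intro)
  show ?thesis
  proof (cases "emeasure M {0<..} = 0")
    case True
    have "{0..} - {0} = {0::real<..}" by auto
    then have "log_concave_measure M"
      using single_atom_log_concave[of 0] True by simp
    then show ?thesis
      using neg_root_convex_of_atom_at_zero[OF True] by simp
  next
    case False
    show ?thesis
      using neg_root_convex_iff_moment_inequality[OF False]
        log_concave_imp_moment_inequality moment_inequality_imp_log_concave[OF False] by blast
  qed
qed

end
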